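(* Let $n\ge2$, let $g$ be an admissible function (as defined in the context), and let $\widehat\alpha\in[0,1]$, $\widehat\beta\in[0,\frac12]$ with $\widehat\alpha+\widehat\beta\le1$. Let $f\in\overline{\mathcal S_g^0(\mathbb D)}$ and $F=\Phi_{n,\widehat\alpha,\widehat\beta}(f)$. Let $f(z_1,t)$ be a $g$-Loewner chain on $\mathbb D$ with $f=f(\cdot,0)$, and let $F_{\widehat\alpha,\widehat\beta}(z,t)$ be the $g$-Loewner chain on $\mathbb B^n$ given by $$F_{\widehat\alpha,\widehat\beta}(z,t)=\left(f(z_1,t),\ \tilde z\,e^{(1-\widehat\alpha-\widehat\beta)t}\left(\frac{f(z_1,t)}{z_1}\right)^{\widehat\alpha}\bigl(f'(z_1,t)\bigr)^{\widehat\beta}\right),\quad z=(z_1,\tilde z)\in\mathbb B^n,\ t\ge0,$$ so that $F=F_{\widehat\alpha,\widehat\beta}(\cdot,0)$. If $F\in\mathrm{ex}\,\Phi_{n,\widehat\alpha,\widehat\beta}\bigl(\overline{\mathcal S_g^0(\mathbb D)}\bigr)$, then $e^{-t}F_{\widehat\alpha,\widehat\beta}(\cdot,t)\in\mathrm{ex}\,\Phi_{n,\widehat\alpha,\widehat\beta}\bigl(\overline{\mathcal S_g^0(\mathbb D)}\bigr)$ for all $t\ge0$.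
   Context: $\mathbb B^n$ is the open Euclidean unit ball of $\mathbb C^n$ with inner product $\langle z,w\rangle=\sum_j z_j\overline{w_j}$ and norm $\|z\|$; $\mathbb D=\mathbb B^1$. $H(\mathbb B^n)$ is the space of holomorphic mappings $\mathbb B^n\to\mathbb C^n$ with the topology of locally uniform convergence; closures are taken in this topology. $J_f$ is the complex Jacobian matrix (in $z$); $I_n$ is the identity matrix. Write $z=(z_1,\tilde z)$, $\tilde z=(z_2,\dots,z_n)$; $f'(z_1,t)$ is the derivative in $z_1$. Admissible function: a univalent holomorphic $g:\mathbb D\to\mathbb C$ with $g(0)=1$, $g(\overline\zeta)=\overline{g(\zeta)}$ and $\Re g(\zeta)>0$ on $\mathbb D$, and for every $r\in(0,1)$, $\min_{|\zeta|=r}\Re g(\zeta)=\min\{g(r),g(-r)\}$ and $\max_{|\zeta|=r}\Re g(\zeta)=\max\{g(r),g(-r)\}$. $\mathcal M_g$ is the set of $h\in H(\mathbb B^n)$ with $h(0)=0$, $J_h(0)=I_n$ and $\langle h(z),z/\|z\|^2\rangle\in g(\mathbb D)$ for $z\in\mathbb B^n\setminus\{0\}$. A Loewner chain is a mapping $f:\mathbb B^n\times[0,\infty)\to\mathbb C^n$ such that each $f(\cdot,t)$ is biholomorphic on $\mathbb B^n$ (onto its image), $f(0,t)=0$, $J_f(0,t)=e^tI_n$, and for $0\le s\le t$ there is a holomorphic $v(\cdot,s,t):\mathbb B^n\to\mathbb B^n$ with $\|v(z,s,t)\|\le\|z\|$ and $f(z,s)=f(v(z,s,t),t)$. It is a $g$-Loewner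 chain if in addition $\{e^{-t}f(\cdot,t)\}_{t\ge0}$ is a normal family on $\mathbb B^n$ and the mapping $h(z,t)$ (measurable in $t$) in the Loewner differential equation $\frac{\partial f}{\partial t}(z,t)=J_f(z,t)h(z,t)$ (a.e. $t\ge0$, all $z\in\mathbb B^n$) satisfies $h(\cdot,t)\in\mathcal M_g$ for a.e. $t\ge0$. These definitions are also used with $n=1$. $\mathcal S_g^0(\mathbb B^n)$ is the set of normalized (i.e. $f(0)=0$, $J_f(0)=I_n$) holomorphic $f:\mathbb B^n\to\mathbb C^n$ such that $f=f(\cdot,0)$ for some $g$-Loewner chain $f(z,t)$ (mappings with $g$-parametric representation); $\mathcal S_g^0(\mathbb D)$ is the case $n=1$. Extension operator: for locally univalent $f$ on $\mathbb D$ with $f(0)=f'(0)-1=0$ and $f(z_1)\ne0$ for $z_1\ne0$, $$\Phi_{n,\widehat\alpha,\widehat\beta}(f)(z)=\left(f(z_1),\ \tilde z\left(\frac{f(z_1)}{z_1}\right)^{\widehat\alpha}(f'(z_1))^{\widehat\beta}\right),\quad z\in\mathbb B^n,$$ with the power branches equal to $1$ at $z_1=0$. In the formula for $F_{\widehat\alpha,\widehat\beta}(z,t)$ the branches are those with values $e^{\widehat\alpha t}$ and $e^{\widehat\beta t}$, respectively, at $z_1=0$. For a nonempty $\mathcal F\subset H(\mathbb B^n)$, $\mathrm{ex}\,\mathcal F$ is the set of extreme points: $f\in\mathcal F$ such that $f=\lambda p+(1-\lambda)q$ with $\lambda\in(0,1)$, $p,q\in\mathcal F$ implies $f=p=q$.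 *)

theory Defs
  imports "HOL-Complex_Analysis.Complex_Analysis"
begin

abbreviation unit_disc :: "complex set" where
  "unit_disc \<equiv> ball 0 1"

abbreviation unit_ball :: "(complex ^ 'n) set" where
  "unit_ball \<equiv> ball 0 1"

(* The elements of sets of mappings of the disc or the ball are functions that are
   undefined off the disc (ball), i.e. extensional, so that = means equality of mappings. *)

definition hol_disc :: "(complex \<Rightarrow> complex) set" where
  "hol_disc = {f \<in> extensional unit_disc. f holomorphic_on unit_disc}"

definition loc_unif_topology :: "(complex \<Rightarrow> complex) topology" where
  "loc_unif_topology = topology_generated_by
     {{p \<in> hol_disc. \<forall>z\<in>K. dist (p z) (f z) < e} | f K e.
        f \<in> hol_disc \<and> compact K \<and> K \<subseteq> unit_disc \<and> e > 0}"

definition normal_family :: "(complex \<Rightarrow> complex) set \<Rightarrow> bool" where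
  "normal_family \<F> \<longleftrightarrow>
     (\<forall>\<phi> :: nat \<Rightarrow> complex \<Rightarrow> complex. range \<phi> \<subseteq> \<F> \<longrightarrow>
        (\<exists>r l. strict_mono r \<and>
           (\<forall>K. compact K \<and> K \<subseteq> unit_disc \<longrightarrow>
              uniform_limit K (\<lambda>m. \<phi> (r m)) l sequentially)))"

definition admissible :: "(complex \<Rightarrow> complex) \<Rightarrow> bool" where
  "admissible g \<longleftrightarrow>
     g holomorphic_on unit_disc \<and> inj_on g unit_disc \<and> g 0 = 1 \<and>
     (\<forall>\<zeta>\<in>unit_disc. g (cnj \<zeta>) = cnj (g \<zeta>)) \<and>
     (\<forall>\<zeta>\<in>unit_disc. Re (g \<zeta>) > 0) \<and>
     (\<forall>r::real. 0 < r \<and> r < 1 \<longrightarrow>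
        (INF \<zeta>\<in>sphere 0 r. Re (g \<zeta>)) = min (Re (g (of_real r))) (Re (g (- of_real r))) \<and>
        (SUP \<zeta>\<in>sphere 0 r. Re (g \<zeta>)) = max (Re (g (of_real r))) (Re (g (- of_real r))))"

(* M_g, Loewner chains, g-Loewner chains and S_g^0 in dimension one: the Jacobian matrix is
   the derivative and <z, w> = z * cnj w. *)

definition class_M :: "(complex \<Rightarrow> complex) \<Rightarrow> (complex \<Rightarrow> complex) set" where
  "class_M g = {h. h holomorphic_on unit_disc \<and> h 0 = 0 \<and> deriv h 0 = 1 \<and>
     (\<forall>z\<in>unit_disc - {0}. h z * cnj (z / of_real ((norm z)\<^sup>2)) \<in> g ` unit_disc)}"

definition biholomorphic_on_disc :: "(complex \<Rightarrow> complex) \<Rightarrow> bool" where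
  "biholomorphic_on_disc f \<longleftrightarrow>
     f holomorphic_on unit_disc \<and> inj_on f unit_disc \<and> open (f ` unit_disc) \<and>
     the_inv_into unit_disc f holomorphic_on (f ` unit_disc)"

definition Loewner_chain :: "(complex \<Rightarrow> real \<Rightarrow> complex) \<Rightarrow> bool" where
  "Loewner_chain f \<longleftrightarrow>
     (\<forall>t\<ge>0. biholomorphic_on_disc (\<lambda>z. f z t) \<and> f 0 t = 0 \<and>
        deriv (\<lambda>z. f z t) 0 = of_real (exp t)) \<and>
     (\<forall>s t. 0 \<le> s \<and> s \<le> t \<longrightarrow>
        (\<exists>v. v holomorphic_on unit_disc \<and> v ` unit_disc \<subseteq> unit_disc \<and>
           (\<forall>z\<in>unit_disc. norm (v z) \<le> norm z \<and> f z s = f (v z) t)))"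

definition g_Loewner_chain ::
    "(complex \<Rightarrow> complex) \<Rightarrow> (complex \<Rightarrow> real \<Rightarrow> complex) \<Rightarrow> bool" where
  "g_Loewner_chain g f \<longleftrightarrow>
     Loewner_chain f \<and>
     normal_family {\<lambda>z. of_real (exp (- t)) * f z t | t. t \<ge> 0} \<and>
     (\<exists>h :: complex \<Rightarrow> real \<Rightarrow> complex.
        (\<forall>z\<in>unit_disc. h z \<in> borel_measurable (lebesgue_on {0..})) \<and>
        (AE t in lebesgue_on {0..}. \<forall>z\<in>unit_disc.
           (f z has_vector_derivative deriv (\<lambda>w. f w t) z * h z t) (at t within {0..})) \<and>
        (AE t in lebesgue_on {0..}. (\<lambda>z. h z t) \<in> class_M g))"

definition class_S0 :: "(complex \<Rightarrow> complex) \<Rightarrow> (complex \<Rightarrow> complex) set" where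
  "class_S0 g = {f \<in> hol_disc. f 0 = 0 \<and> deriv f 0 = 1 \<and>
     (\<exists>F. g_Loewner_chain g F \<and> (\<forall>z\<in>unit_disc. f z = F z 0))}"

(* power_branch q a c is the branch of q^a on the disc with value c at 0, for a zero-free
   holomorphic q and one of the values c of q(0)^a; its values off the disc are irrelevant. *)
definition power_branch ::
    "(complex \<Rightarrow> complex) \<Rightarrow> real \<Rightarrow> complex \<Rightarrow> complex \<Rightarrow> complex" where
  "power_branch q a c = (SOME P. P 0 = c \<and>
     (\<exists>L. L holomorphic_on unit_disc \<and>
        (\<forall>z\<in>unit_disc. exp (L z) = q z \<and> P z = exp (of_real a * L z))))"

(* f(z)/z with the removable singularity at 0 filled in, for f(0) = 0 *)
definition quot_at_0 :: "(complex \<Rightarrow> complex) \<Rightarrow> complex \<Rightarrow> complex" where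
  "quot_at_0 f z = (if z = 0 then deriv f 0 else f z / z)"

(* The index k plays the role of the first coordinate; the other coordinates form z-tilde.
   The definition is meaningful for normalized locally univalent f vanishing only at 0. *)
definition ext_op :: "'n::finite \<Rightarrow> real \<Rightarrow> real \<Rightarrow> (complex \<Rightarrow> complex) \<Rightarrow>
    complex ^ 'n \<Rightarrow> complex ^ 'n" where
  "ext_op k \<alpha> \<beta> f = restrict (\<lambda>z. \<chi> i.
     if i = k then f (z $ k)
     else z $ i * power_branch (quot_at_0 f) \<alpha> 1 (z $ k) * power_branch (deriv f) \<beta> 1 (z $ k))
   unit_ball"

definition ext_chain :: "'n::finite \<Rightarrow> real \<Rightarrow> real \<Rightarrow> (complex \<Rightarrow> real \<Rightarrow> complex) \<Rightarrow>
    complex ^ 'n \<Rightarrow> real \<Rightarrow> complex ^ 'n" where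
  "ext_chain k \<alpha> \<beta> f z t = (\<chi> i.
     if i = k then f (z $ k) t
     else z $ i * of_real (exp ((1 - \<alpha> - \<beta>) * t))
       * power_branch (quot_at_0 (\<lambda>w. f w t)) \<alpha> (of_real (exp (\<alpha> * t))) (z $ k)
       * power_branch (deriv (\<lambda>w. f w t)) \<beta> (of_real (exp (\<beta> * t))) (z $ k))"

definition extreme_maps ::
    "(complex ^ 'n \<Rightarrow> complex ^ 'n) set \<Rightarrow> (complex ^ 'n \<Rightarrow> complex ^ 'n) set" where
  "extreme_maps \<F> = {f \<in> \<F>. \<forall>p\<in>\<F>. \<forall>q\<in>\<F>. \<forall>u::real. 0 < u \<and> u < 1 \<and>
     f = restrict (\<lambda>z. u *\<^sub>R p z + (1 - u) *\<^sub>R q z) unit_ball \<longrightarrow> f = p \<and> f = q}"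

end

(* A g-Loewner chain f(z,t) with transition map v = v(.,0,t) satisfies f(.,0) = T(e^{-t} f(.,t)) for
   the operator T p = e^t (p o v). Concatenating the chain f on [0,t] with a chain of p shows that T
   maps S_g^0 into itself, and T is continuous, so it preserves the closure. The z-tilde part of
   Phi(T p) is a multiplier independent of p times the corresponding factor of Phi(p) evaluated at
   v(z_1). Hence a convex decomposition of Phi(e^{-t} f(.,t)) into Phi(p) and Phi(q) is carried to
   one of Phi(f) into Phi(T p) and Phi(T q). Extremality of Phi(f) gives p o v = e^{-t} f(v(.),t),
   and the identity theorem on the open set v(D) gives p = e^{-t} f(.,t). *)
theory Submission
  imports Defs
begin

unbundle no fps_syntax

subsection \<open>Branches of powers and the extension operator\<close>

text \<open>Phi is not linear, so a convex decomposition of Phi(f) contains two linear relations: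
  one between the functions and one between the multipliers (p(z)/z)^\<alpha> (p'(z))^\<beta>. The
  operator T has to respect both at once. It does because (T p)(z)/z and (T p)'(z) are the
  corresponding quantities of p at v(z) times e^t v(z)/z and e^t v'(z). These last two have value 1
  at 0, as v'(0) = e^{-t}, so normalized logarithms add and the branches match without a correcting
  constant. Logarithms require p(z)/z and p' to be zero-free for every p in the closure, not only in
  S_g^0; Hurwitz's theorem gives this by keeping the limits univalent. That e^{-t} f(.,t) lies in
  S_g^0 at all comes from restarting the chain at time t and rescaling it.\<close>

definition univalent_disc :: "real \<Rightarrow> (complex \<Rightarrow> complex) set" where
  "univalent_disc s = {p. p holomorphic_on unit_disc \<and> inj_on p unit_disc \<and> p 0 = 0 \<and>
     deriv p 0 = of_real (exp s)}"

lemma univalent_discD: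
  assumes "p \<in> univalent_disc s"
  shows "p holomorphic_on unit_disc" "inj_on p unit_disc" "p 0 = 0"
    "deriv p 0 = of_real (exp s)"
  using assms by (auto simp: univalent_disc_def)

lemma deriv_univalent_nonzero:
  assumes "p \<in> univalent_disc s" "z \<in> unit_disc"
  shows "deriv p z \<noteq> 0"
  using holomorphic_injective_imp_regular[of p unit_disc z] assms
  by (auto simp: univalent_disc_def)

lemma holomorphic_deriv_cong:
  assumes "open S" "z \<in> S" "\<And>w. w \<in> S \<Longrightarrow> p w = q w"
  shows "deriv p z = deriv q z"
  using assms eventually_nhds by (intro deriv_cong_ev) blast+

lemma quot_at_0_holomorphic:
  assumes "p holomorphic_on unit_disc" "p 0 = 0"
  shows "quot_at_0 p holomorphic_on unit_disc"
proof -
  have "(\<lambda>z. if z = 0 then deriv p 0 else (p z - p 0) / (z - 0)) holomorphic_on unit_disc"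
    by (rule pole_lemma[OF assms(1)]) simp
  then show ?thesis
    by (rule holomorphic_transform) (simp add: quot_at_0_def assms(2))
qed

lemma quot_at_0_nonzero:
  assumes "p \<in> univalent_disc s" "z \<in> unit_disc"
  shows "quot_at_0 p z \<noteq> 0"
proof (cases "z = 0")
  case False
  then have "p z \<noteq> p 0"
    using univalent_discD(2)[OF assms(1)] assms(2) by (metis centre_in_ball inj_onD zero_less_one)
  then show ?thesis
    using False univalent_discD(3)[OF assms(1)] by (simp add: quot_at_0_def)
qed (use univalent_discD(4)[OF assms(1)] in \<open>simp add: quot_at_0_def\<close>)

text \<open>A logarithm exists since the disc is contractible. It can be moved to the value
  \<open>c\<close> at 0 because \<open>c - L 0\<close> is a period of exp.\<close>

lemma holomorphic_log_disc:
  assumes "q holomorphic_on unit_disc" "\<And>z. z \<in> unit_disc \<Longrightarrow> q z \<noteq> 0" "q 0 = exp c"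
  obtains L where "L holomorphic_on unit_disc" "L 0 = c" "\<And>z. z \<in> unit_disc \<Longrightarrow> exp (L z) = q z"
proof -
  obtain L where L: "L holomorphic_on unit_disc" "\<And>z. z \<in> unit_disc \<Longrightarrow> q z = exp (L z)"
    using contractible_imp_holomorphic_log[OF assms(1) convex_imp_contractible[OF convex_ball]]
      assms(2) by metis
  have "exp (c - L 0) = 1"
    using L(2)[of 0] assms(3) by (simp add: exp_diff)
  with L show ?thesis
    by (intro that[of "\<lambda>z. L z + (c - L 0)"]) (auto intro!: holomorphic_intros simp: exp_add)
qed

text \<open>Differentiating exp L = exp M and cancelling the common exponential gives L' = M', so L
  - M is constant on the disc.\<close>

lemma holomorphic_log_unique_disc:
  assumes L: "L holomorphic_on unit_disc" and M: "M holomorphic_on unit_disc"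
    and eq: "\<And>z. z \<in> unit_disc \<Longrightarrow> exp (L z) = exp (M z)" and z: "z \<in> unit_disc"
  shows "L z - M z = L 0 - M 0"
proof -
  have "((\<lambda>z. L z - M z) has_field_derivative 0) (at w within unit_disc)" if w: "w \<in> unit_disc" for w
  proof -
    have dL: "(L has_field_derivative deriv L w) (at w)"
      and dM: "(M has_field_derivative deriv M w) (at w)"
      using holomorphic_derivI[OF L _ w] holomorphic_derivI[OF M _ w] by auto
    have "((\<lambda>z. exp (L z)) has_field_derivative exp (L w) * deriv L w) (at w)"
      "((\<lambda>z. exp (M z)) has_field_derivative exp (M w) * deriv M w) (at w)"
      using dL dM by (auto intro!: derivative_eq_intros)
    moreover have "deriv (\<lambda>z. exp (L z)) w = deriv (\<lambda>z. exp (M z)) w"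
      by (rule holomorphic_deriv_cong[OF _ w eq]) auto
    ultimately have "deriv L w = deriv M w"
      using eq[OF w] by (simp add: DERIV_imp_deriv)
    then show ?thesis
      using DERIV_diff[OF dL dM] by (simp add: has_field_derivative_at_within)
  qed
  then have "\<exists>c. \<forall>w\<in>unit_disc. L w - M w = c"
    by (rule has_field_derivative_zero_constant[OF convex_ball])
  then show ?thesis
    using z by (metis centre_in_ball zero_less_one)
qed

text \<open>This removes the Hilbert choice. The logarithm M behind the chosen branch may differ
  from L by a period of exp, and a times that period need not be a period; the prescribed value at 0
  forces exp(a (M 0 - L 0)) = 1, so the branch is determined on the whole disc.\<close>

lemma power_branch_eq_exp:
  assumes L: "L holomorphic_on unit_disc" "\<And>z. z \<in> unit_disc \<Longrightarrow> exp (L z) = q z"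
    and c: "c = exp (of_real a * L 0)" and z: "z \<in> unit_disc"
  shows "power_branch q a c z = exp (of_real a * L z)"
proof -
  let ?R = "\<lambda>P. P 0 = c \<and> (\<exists>L. L holomorphic_on unit_disc \<and>
        (\<forall>z\<in>unit_disc. exp (L z) = q z \<and> P z = exp (of_real a * L z)))"
  have "?R (\<lambda>z. exp (of_real a * L z))"
    using L c by blast
  then have "?R (power_branch q a c)"
    unfolding power_branch_def by (rule someI[of ?R])
  then obtain M where M: "M holomorphic_on unit_disc"
      "\<And>w. w \<in> unit_disc \<Longrightarrow> exp (M w) = q w"
      "\<And>w. w \<in> unit_disc \<Longrightarrow> power_branch q a c w = exp (of_real a * M w)"
    and "power_branch q a c 0 = c"
    by blast
  then have 0: "exp (of_real a * M 0) = exp (of_real a * L 0)"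
    using c by (metis centre_in_ball zero_less_one)
  have "M z - L z = M 0 - L 0"
    using holomorphic_log_unique_disc[OF M(1) L(1) _ z] M(2) L(2) by metis
  then have "of_real a * M z = of_real a * L z + (of_real a * M 0 - of_real a * L 0)"
    by (metis add.commute diff_add_cancel right_diff_distrib)
  then show ?thesis
    using M(3)[OF z] 0 by (simp add: exp_add exp_diff)
qed

text \<open>The common multiplier of all coordinates of z-tilde in Phi(p): the nonlinear part of the
  operator, isolated as a function of one variable.\<close>

definition ext_factor :: "real \<Rightarrow> real \<Rightarrow> (complex \<Rightarrow> complex) \<Rightarrow> complex \<Rightarrow> complex" where
  "ext_factor \<alpha> \<beta> p \<zeta> = power_branch (quot_at_0 p) \<alpha> 1 \<zeta> * power_branch (deriv p) \<beta> 1 \<zeta>"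

text \<open>Both p(z)/z and p' take the value e^s at 0, so both logarithms can be normalized to the
  real number s there. This normalization selects the branches in the operator and in the extended
  chain.\<close>

lemma univalent_logs:
  assumes p: "p \<in> univalent_disc s"
  obtains L M where "L holomorphic_on unit_disc" "M holomorphic_on unit_disc"
    "L 0 = of_real s" "M 0 = of_real s"
    "\<And>z. z \<in> unit_disc \<Longrightarrow> exp (L z) = quot_at_0 p z"
    "\<And>z. z \<in> unit_disc \<Longrightarrow> exp (M z) = deriv p z"
proof -
  note pD = univalent_discD[OF p]
  obtain L where "L holomorphic_on unit_disc" "L 0 = of_real s"
    "\<And>z. z \<in> unit_disc \<Longrightarrow> exp (L z) = quot_at_0 p z"
    using holomorphic_log_disc[OF quot_at_0_holomorphic[OF pD(1,3)] quot_at_0_nonzero[OF p],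
        of "of_real s"] pD(4) exp_of_real[of s, where 'a=complex] by (auto simp: quot_at_0_def)
  moreover obtain M where "M holomorphic_on unit_disc" "M 0 = of_real s"
    "\<And>z. z \<in> unit_disc \<Longrightarrow> exp (M z) = deriv p z"
    using holomorphic_log_disc[OF holomorphic_deriv[OF pD(1) open_ball]
        deriv_univalent_nonzero[OF p], of "of_real s"] pD(4) exp_of_real[of s, where 'a=complex]
    by metis
  ultimately show ?thesis
    using that by blast
qed

text \<open>The index of \<open>univalent_disc\<close> is the logarithm of the derivative at 0, so
  indices add under composition and scaling by e^t adds t. Taking v to be the identity, with index
  0, transfers these facts to rescaled functions or to functions that agree only on the
  disc.\<close>

lemma compose_univalent:
  assumes p: "p \<in> univalent_disc s" and v: "v \<in> univalent_disc r" "v ` unit_disc \<subseteq> unit_disc"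
    and q: "\<forall>z\<in>unit_disc. q z = of_real (exp t) * p (v z)"
  shows "q \<in> univalent_disc (t + s + r)"
    and "z \<in> unit_disc \<Longrightarrow> deriv q z = of_real (exp t) * deriv p (v z) * deriv v z"
    and "z \<in> unit_disc \<Longrightarrow> quot_at_0 q z = of_real (exp t) * quot_at_0 p (v z) * quot_at_0 v z"
proof -
  note pD = univalent_discD[OF p] and vD = univalent_discD[OF v(1)]
  have der: "deriv q z = of_real (exp t) * deriv p (v z) * deriv v z" if z: "z \<in> unit_disc" for z
  proof -
    have "(p has_field_derivative deriv p (v z)) (at (v z))"
      using holomorphic_derivI[OF pD(1)] v(2) z by (metis image_subset_iff open_ball)
    moreover have "(v has_field_derivative deriv v z) (at z)"
      using holomorphic_derivI[OF vD(1)] z by (metis open_ball)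
    ultimately have "((\<lambda>z. of_real (exp t) * p (v z)) has_field_derivative
        of_real (exp t) * (deriv p (v z) * deriv v z)) (at z)"
      by (intro DERIV_cmult DERIV_chain2)
    moreover have "deriv q z = deriv (\<lambda>z. of_real (exp t) * p (v z)) z"
      using q by (intro holomorphic_deriv_cong[OF _ z]) auto
    ultimately show ?thesis
      by (simp add: DERIV_imp_deriv)
  qed
  then show "z \<in> unit_disc \<Longrightarrow> deriv q z = of_real (exp t) * deriv p (v z) * deriv v z" .
  have "(\<lambda>z. of_real (exp t) * p (v z)) holomorphic_on unit_disc"
    using holomorphic_on_compose_gen[OF vD(1) pD(1) v(2)] by (auto intro!: holomorphic_intros simp: o_def)
  then have "q holomorphic_on unit_disc"
    by (rule holomorphic_transform) (use q in simp)
  moreover have "inj_on q unit_disc"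
  proof (rule inj_onI)
    fix x y assume *: "x \<in> unit_disc" "y \<in> unit_disc" "q x = q y"
    then have "p (v x) = p (v y)"
      using bspec[OF q, of x] bspec[OF q, of y] by simp
    then have "v x = v y"
      by (rule inj_onD[OF pD(2)]) (use * v(2) in blast)+
    then show "x = y"
      by (rule inj_onD[OF vD(2)]) (use * in auto)
  qed
  ultimately show "q \<in> univalent_disc (t + s + r)"
    using bspec[OF q, of 0] der[of 0] pD vD by (simp add: univalent_disc_def exp_add)
  have "v z \<noteq> 0" if "z \<in> unit_disc" "z \<noteq> 0"
    using that vD(2,3) by (metis centre_in_ball inj_onD zero_less_one)
  then show "quot_at_0 q z = of_real (exp t) * quot_at_0 p (v z) * quot_at_0 v z"
    if "z \<in> unit_disc"
    using that bspec[OF q that] der[of 0] vD(3) by (auto simp: quot_at_0_def)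
qed

text \<open>E is (e^t v(z)/z)^\<alpha> (e^t v'(z))^\<beta>, which involves only v and t. Having one
  E for all p is what lets linear relations between multipliers survive the passage from p to
  q.\<close>

lemma ext_factor_compose:
  assumes v: "v \<in> univalent_disc (- t)" "v ` unit_disc \<subseteq> unit_disc"
  shows "\<exists>E. \<forall>p\<in>univalent_disc 0. \<forall>q. (\<forall>z\<in>unit_disc. q z = of_real (exp t) * p (v z)) \<longrightarrow>
      (\<forall>z\<in>unit_disc. ext_factor \<alpha> \<beta> q z = E z * ext_factor \<alpha> \<beta> p (v z))"
proof -
  obtain L M where LM: "L holomorphic_on unit_disc" "M holomorphic_on unit_disc"
    "L 0 = of_real (- t)" "M 0 = of_real (- t)"
    "\<And>z. z \<in> unit_disc \<Longrightarrow> exp (L z) = quot_at_0 v z"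
    "\<And>z. z \<in> unit_disc \<Longrightarrow> exp (M z) = deriv v z"
    using univalent_logs[OF v(1)] by blast
  note vD = univalent_discD[OF v(1)]
  have vz: "v z \<in> unit_disc" if "z \<in> unit_disc" for z
    using that v(2) by blast
  show ?thesis
  proof (intro exI[of _ "\<lambda>z. exp (of_real \<alpha> * (of_real t + L z)) * exp (of_real \<beta> * (of_real t + M z))"]
      ballI allI impI)
    fix p q :: "complex \<Rightarrow> complex" and z :: complex
    assume p: "p \<in> univalent_disc 0"
      and q: "\<forall>z\<in>unit_disc. q z = of_real (exp t) * p (v z)"
      and z: "z \<in> unit_disc"
    obtain L' M' where LM': "L' holomorphic_on unit_disc" "M' holomorphic_on unit_disc"
      "L' 0 = 0" "M' 0 = 0"
      "\<And>z. z \<in> unit_disc \<Longrightarrow> exp (L' z) = quot_at_0 p z"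
      "\<And>z. z \<in> unit_disc \<Longrightarrow> exp (M' z) = deriv p z"
      using univalent_logs[OF p] by (metis of_real_0)
    have comp: "(\<lambda>z. L' (v z)) holomorphic_on unit_disc" "(\<lambda>z. M' (v z)) holomorphic_on unit_disc"
      using holomorphic_on_compose_gen[OF vD(1) _ v(2)] LM'(1,2) by (auto simp: o_def)
    have et: "exp (of_real t) = (of_real (exp t) :: complex)"
      by (simp add: exp_of_real)
    \<comment> \<open>The logarithm t + L + L' o v vanishes at 0, since \<open>L 0\<close> is -t,
      \<open>v 0\<close> is 0 and \<open>L' 0\<close> is 0. So it yields the branch with value
      1.\<close>
    have "power_branch (quot_at_0 q) \<alpha> 1 z = exp (of_real \<alpha> * (of_real t + L z + L' (v z)))"
      using LM LM' vD(3) compose_univalent(3)[OF p v q] z vz comp et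
      by (intro power_branch_eq_exp) (auto intro!: holomorphic_intros simp: exp_add)
    moreover have "power_branch (deriv q) \<beta> 1 z = exp (of_real \<beta> * (of_real t + M z + M' (v z)))"
      using LM LM' vD(3) compose_univalent(2)[OF p v q] z vz comp et
      by (intro power_branch_eq_exp) (auto intro!: holomorphic_intros simp: exp_add)
    moreover have "power_branch (quot_at_0 p) \<alpha> 1 (v z) = exp (of_real \<alpha> * L' (v z))"
      using LM' vz[OF z] by (intro power_branch_eq_exp) auto
    moreover have "power_branch (deriv p) \<beta> 1 (v z) = exp (of_real \<beta> * M' (v z))"
      using LM' vz[OF z] by (intro power_branch_eq_exp) auto
    ultimately show "ext_factor \<alpha> \<beta> q z = exp (of_real \<alpha> * (of_real t + L z)) *
        exp (of_real \<beta> * (of_real t + M z)) * ext_factor \<alpha> \<beta> p (v z)"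
      by (simp add: ext_factor_def exp_add distrib_left)
  qed
qed

section \<open>Convex combinations of extended maps\<close>

lemma nth_in_unit_disc: "z \<in> unit_ball \<Longrightarrow> z $ k \<in> unit_disc"
  using Finite_Cartesian_Product.norm_nth_le[of z k] by simp

lemma norm_axis: "norm (axis k x :: complex ^ 'n) = norm x"
  by (simp add: norm_eq_sqrt_inner inner_axis)

text \<open>Coordinate k sees only the functions and every other coordinate only the multipliers;
  dimension at least two supplies such a coordinate. Since u is an arbitrary real, the case u = 1
  also covers plain equality of two extended maps.\<close>

lemma ext_op_eq_convex_iff:
  fixes k :: "'n::finite"
  assumes "CARD('n) \<ge> 2"
  shows "ext_op k \<alpha> \<beta> r = restrict (\<lambda>z. u *\<^sub>R ext_op k \<alpha> \<beta> p z + (1 - u) *\<^sub>R ext_op k \<alpha> \<beta> q z) unit_ball \<longleftrightarrow>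
    (\<forall>\<zeta>\<in>unit_disc. r \<zeta> = u *\<^sub>R p \<zeta> + (1 - u) *\<^sub>R q \<zeta> \<and>
      ext_factor \<alpha> \<beta> r \<zeta> = u *\<^sub>R ext_factor \<alpha> \<beta> p \<zeta> + (1 - u) *\<^sub>R ext_factor \<alpha> \<beta> q \<zeta>)"
    (is "?l = restrict ?r _ \<longleftrightarrow> ?D")
proof
  assume eq: "?l = restrict ?r unit_ball"
  obtain i where i: "i \<noteq> k"
  proof -
    have "UNIV \<noteq> {k}"
      using assms by (auto dest: arg_cong[of _ _ card])
    then show ?thesis
      using that by blast
  qed
  show ?D
  proof
    fix \<zeta> :: complex assume \<zeta>: "\<zeta> \<in> unit_disc"
    \<comment> \<open>Half of the distance from \<zeta> to the unit circle: the test point w stays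
      in the ball, and its i-th coordinate is nonzero, so it can be cancelled from the multiplier
      identity.\<close>
    define e where "e = (1 - norm \<zeta>) / 2"
    define w :: "complex ^ 'n" where "w = axis k \<zeta> + axis i (of_real e)"
    have e: "e > 0"
      using \<zeta> by (simp add: e_def)
    have "norm w \<le> norm \<zeta> + e"
      using norm_triangle_ineq[of "axis k \<zeta>" "axis i (of_real e)"] e
      by (simp add: w_def norm_axis)
    then have w: "w \<in> unit_ball"
      using \<zeta> by (simp add: e_def field_simps)
    have wk: "w $ k = \<zeta>" "w $ i = of_real e"
      using i by (auto simp: w_def axis_def)
    have *: "ext_op k \<alpha> \<beta> r w = u *\<^sub>R ext_op k \<alpha> \<beta> p w + (1 - u) *\<^sub>R ext_op k \<alpha> \<beta> q w"
      using eq w by (metis (no_types, lifting) restrict_apply')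
    have comp: "ext_op k \<alpha> \<beta> r w $ j = u *\<^sub>R (ext_op k \<alpha> \<beta> p w $ j) + (1 - u) *\<^sub>R (ext_op k \<alpha> \<beta> q w $ j)" for j
      unfolding * by simp
    have "r \<zeta> = u *\<^sub>R p \<zeta> + (1 - u) *\<^sub>R q \<zeta>"
      using comp[of k] w wk by (simp add: ext_op_def)
    moreover have "e *\<^sub>R ext_factor \<alpha> \<beta> r \<zeta> =
       e *\<^sub>R (u *\<^sub>R ext_factor \<alpha> \<beta> p \<zeta> + (1 - u) *\<^sub>R ext_factor \<alpha> \<beta> q \<zeta>)"
      using comp[of i] w wk i by (simp add: ext_op_def ext_factor_def scaleR_conv_of_real algebra_simps)
    ultimately show "r \<zeta> = u *\<^sub>R p \<zeta> + (1 - u) *\<^sub>R q \<zeta> \<and>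
      ext_factor \<alpha> \<beta> r \<zeta> = u *\<^sub>R ext_factor \<alpha> \<beta> p \<zeta> + (1 - u) *\<^sub>R ext_factor \<alpha> \<beta> q \<zeta>"
      using e by simp
  qed
next
  assume D: ?D
  show "?l = restrict ?r unit_ball"
  proof
    fix z :: "complex ^ 'n"
    show "?l z = restrict ?r unit_ball z"
    proof (cases "z \<in> unit_ball")
      case True
      note zk = nth_in_unit_disc[OF True, of k]
      have "?l z $ i = ?r z $ i" for i
      proof (cases "i = k")
        case False
        then have "?l z $ i = z $ i * ext_factor \<alpha> \<beta> r (z $ k)"
          using True by (simp add: ext_op_def ext_factor_def)
        also have "\<dots> = z $ i * (u *\<^sub>R ext_factor \<alpha> \<beta> p (z $ k) + (1 - u) *\<^sub>R ext_factor \<alpha> \<beta> q (z $ k))"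
          using D zk by simp
        finally show ?thesis
          using False True by (simp add: ext_op_def ext_factor_def algebra_simps)
      qed (use True D zk in \<open>simp add: ext_op_def\<close>)
      then show ?thesis
        using True by (simp add: vec_eq_iff)
    qed (simp add: ext_op_def)
  qed
qed

text \<open>The exponents balance: -t + (1 - \<alpha> - \<beta>) t = -\<alpha> t - \<beta> t. The
  right side is the change in the two powers when the logarithms with value t at 0 are shifted to
  value 0.\<close>

lemma ext_chain_eq_ext_op:
  assumes f: "(\<lambda>z. f z t) \<in> univalent_disc t"
    and p: "\<forall>z\<in>unit_disc. p z = of_real (exp (- t)) * f z t"
  shows "restrict (\<lambda>z. exp (- t) *\<^sub>R ext_chain k \<alpha> \<beta> f z t) unit_ball = ext_op k \<alpha> \<beta> p"
proof
  fix z
  let ?f = "\<lambda>z. f z t"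
  show "restrict (\<lambda>z. exp (- t) *\<^sub>R ext_chain k \<alpha> \<beta> f z t) unit_ball z = ext_op k \<alpha> \<beta> p z"
  proof (cases "z \<in> unit_ball")
    case True
    note zk = nth_in_unit_disc[OF True, of k]
    obtain L M where LM: "L holomorphic_on unit_disc" "M holomorphic_on unit_disc"
      "L 0 = of_real t" "M 0 = of_real t"
      "\<And>z. z \<in> unit_disc \<Longrightarrow> exp (L z) = quot_at_0 ?f z"
      "\<And>z. z \<in> unit_disc \<Longrightarrow> exp (M z) = deriv ?f z"
      using univalent_logs[OF f] by blast
    \<comment> \<open>p is e^{-t} f(.,t) composed with the identity, so the composition formulas
      give its quotient and derivative.\<close>
    have id: "(\<lambda>z. z) \<in> univalent_disc 0" "(\<lambda>z. z) ` unit_disc \<subseteq> unit_disc"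
      by (auto simp: univalent_disc_def)
    note comp = compose_univalent[OF f id p]
    have et: "exp (- of_real t) = (of_real (exp (- t)) :: complex)"
      using exp_of_real[of "- t", where 'a=complex] by simp
    have q_id: "quot_at_0 (\<lambda>z. z) w = 1" for w
      by (simp add: quot_at_0_def)
    have c: "of_real (exp (a * t)) = exp (of_real a * (of_real t :: complex))" for a
      using exp_of_real[of "a * t", where 'a=complex] by simp
    have 1: "power_branch (quot_at_0 ?f) \<alpha> (of_real (exp (\<alpha> * t))) (z $ k) = exp (of_real \<alpha> * L (z $ k))"
      using LM(3) c zk by (intro power_branch_eq_exp[OF LM(1,5)]) simp_all
    have 2: "power_branch (deriv ?f) \<beta> (of_real (exp (\<beta> * t))) (z $ k) = exp (of_real \<beta> * M (z $ k))"
      using LM(4) c zk by (intro power_branch_eq_exp[OF LM(2,6)]) simp_all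
    have "exp (- of_real t + L w) = quot_at_0 p w" "exp (- of_real t + M w) = deriv p w"
      if "w \<in> unit_disc" for w
      using comp(2,3)[OF that] LM(5,6)[OF that] q_id[of w] by (simp_all only: exp_add et) simp_all
    note pb = power_branch_eq_exp[OF _ this(1)] power_branch_eq_exp[OF _ this(2)]
    have 3: "power_branch (quot_at_0 p) \<alpha> 1 (z $ k) = exp (of_real \<alpha> * (- of_real t + L (z $ k)))"
      using LM(1,3) zk by (intro pb) (auto intro!: holomorphic_intros)
    have 4: "power_branch (deriv p) \<beta> 1 (z $ k) = exp (of_real \<beta> * (- of_real t + M (z $ k)))"
      using LM(2,4) zk by (intro pb) (auto intro!: holomorphic_intros)
    have "of_real (exp (- t)) * of_real (exp ((1 - \<alpha> - \<beta>) * t)) * exp (of_real \<alpha> * L (z $ k)) * exp (of_real \<beta> * M (z $ k)) =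
      (exp (of_real \<alpha> * (- of_real t + L (z $ k))) * exp (of_real \<beta> * (- of_real t + M (z $ k))) :: complex)"
      unfolding exp_of_real[symmetric] exp_add[symmetric] by (simp add: algebra_simps)
    then have *: "z $ i * exp (of_real \<alpha> * (- of_real t + L (z $ k))) * exp (of_real \<beta> * (- of_real t + M (z $ k))) =
      of_real (exp (- t)) * (z $ i * of_real (exp ((1 - \<alpha> - \<beta>) * t)) *
        exp (of_real \<alpha> * L (z $ k)) * exp (of_real \<beta> * M (z $ k)))" for i
      by (metis (no_types, lifting) mult.assoc mult.left_commute)
    have "ext_op k \<alpha> \<beta> p z $ i = exp (- t) *\<^sub>R ext_chain k \<alpha> \<beta> f z t $ i" for i
    proof (cases "i = k")
      case False
      have "ext_op k \<alpha> \<beta> p z $ i = z $ i * power_branch (quot_at_0 p) \<alpha> 1 (z $ k) *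
          power_branch (deriv p) \<beta> 1 (z $ k)"
        using True False by (simp add: ext_op_def)
      also have "\<dots> = of_real (exp (- t)) * ext_chain k \<alpha> \<beta> f z t $ i"
        unfolding 3 4 * using False by (simp only: ext_chain_def 1 2 vec_lambda_beta if_False)
      finally show ?thesis
        by (simp only: scaleR_conv_of_real)
    qed (use True zk p in \<open>simp add: ext_op_def ext_chain_def scaleR_conv_of_real\<close>)
    then show ?thesis
      using True by (simp add: vec_eq_iff)
  qed (simp add: ext_op_def)
qed

subsection \<open>Loewner chains\<close>

lemma AE_lebesgue_translation:
  fixes c :: "'a::euclidean_space"
  assumes "AE x in lebesgue. P x"
  shows "AE x in lebesgue. P (c + x)"
proof -
  obtain N where N: "N \<in> null_sets lebesgue" "{x. \<not> P x} \<subseteq> N"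
    using assms by (auto simp: eventually_ae_filter)
  then have "negligible ((+) (- c) ` N)"
    by (intro negligible_translation) (simp add: negligible_iff_null_sets)
  moreover have "{x. \<not> P (c + x)} \<subseteq> (+) (- c) ` N"
  proof
    fix x assume "x \<in> {x. \<not> P (c + x)}"
    then have "c + x \<in> N"
      using N(2) by blast
    then show "x \<in> (+) (- c) ` N"
      by (rule rev_image_eqI) simp
  qed
  ultimately show ?thesis
    by (intro AE_I'[of "(+) (- c) ` N"]) (auto simp: negligible_iff_null_sets)
qed

lemma lebesgue_measurable_translation:
  fixes c :: "'a::euclidean_space"
  shows "(\<lambda>x. c + x) \<in> lebesgue \<rightarrow>\<^sub>M lebesgue"
  using lebesgue_affine_measurable[of "\<lambda>_. 1" c] by (simp add: euclidean_representation)

text \<open>In one variable an injective holomorphic function has an open image and a holomorphic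
  inverse, so checking a chain reduces to univalence.\<close>

lemma biholomorphic_on_disc_iff:
  "biholomorphic_on_disc f \<longleftrightarrow> f holomorphic_on unit_disc \<and> inj_on f unit_disc"
proof
  assume f: "f holomorphic_on unit_disc \<and> inj_on f unit_disc"
  then obtain w where w: "w holomorphic_on f ` unit_disc" "\<And>z. z \<in> unit_disc \<Longrightarrow> w (f z) = z"
    using holomorphic_has_inverse[of f unit_disc] by blast
  have "the_inv_into unit_disc f holomorphic_on f ` unit_disc"
    using w(1) by (rule holomorphic_transform) (use f w(2) in \<open>auto simp: the_inv_into_f_f\<close>)
  then show "biholomorphic_on_disc f"
    using f open_mapping_thm3[of f unit_disc] by (auto simp: biholomorphic_on_disc_def)
qed (simp add: biholomorphic_on_disc_def)

lemma Loewner_chain_univalent: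
  assumes "Loewner_chain f" "t \<ge> 0"
  shows "(\<lambda>z. f z t) \<in> univalent_disc t"
  using assms by (auto simp: Loewner_chain_def biholomorphic_on_disc_iff univalent_disc_def)

lemma Loewner_chainI:
  assumes "\<And>t. t \<ge> 0 \<Longrightarrow> (\<lambda>z. f z t) \<in> univalent_disc t"
    and "\<And>s t. 0 \<le> s \<Longrightarrow> s \<le> t \<Longrightarrow> \<exists>v. v holomorphic_on unit_disc \<and> v ` unit_disc \<subseteq> unit_disc \<and>
           (\<forall>z\<in>unit_disc. norm (v z) \<le> norm z \<and> f z s = f (v z) t)"
  shows "Loewner_chain f"
  using assms by (simp add: Loewner_chain_def biholomorphic_on_disc_iff univalent_disc_def)

text \<open>The bound |v(z)| \<le> |z| gives v(0) = 0, injectivity is inherited from f(.,s), and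
  differentiating f(z,s) = f(v(z),t) at 0 gives v'(0) = e^{s-t}.\<close>

lemma Loewner_chain_transition:
  assumes f: "Loewner_chain f" and st: "0 \<le> s" "s \<le> t"
  obtains v where "v \<in> univalent_disc (s - t)" "v ` unit_disc \<subseteq> unit_disc"
    "\<And>z. z \<in> unit_disc \<Longrightarrow> norm (v z) \<le> norm z" "\<And>z. z \<in> unit_disc \<Longrightarrow> f z s = f (v z) t"
proof -
  obtain v where v: "v holomorphic_on unit_disc" "v ` unit_disc \<subseteq> unit_disc"
    "\<And>z. z \<in> unit_disc \<Longrightarrow> norm (v z) \<le> norm z" "\<And>z. z \<in> unit_disc \<Longrightarrow> f z s = f (v z) t"
    using f st unfolding Loewner_chain_def by metis
  have fs: "(\<lambda>z. f z s) \<in> univalent_disc s" and ft: "(\<lambda>z. f z t) \<in> univalent_disc t"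
    using Loewner_chain_univalent[OF f] st by auto
  have v0: "v 0 = 0"
    using v(3)[of 0] by simp
  have "inj_on v unit_disc"
  proof (rule inj_onI)
    fix x y assume xy: "x \<in> unit_disc" "y \<in> unit_disc" "v x = v y"
    then have "f x s = f y s"
      using v(4) by metis
    then show "x = y"
      using inj_onD[OF univalent_discD(2)[OF fs]] xy by blast
  qed
  moreover have "deriv v 0 = of_real (exp (s - t))"
  proof -
    have "((\<lambda>z. f z t) has_field_derivative of_real (exp t)) (at (v 0))"
      using holomorphic_derivI[OF univalent_discD(1)[OF ft] open_ball, of 0] univalent_discD(4)[OF ft] v0
      by simp
    moreover have "(v has_field_derivative deriv v 0) (at 0)"
      using holomorphic_derivI[OF v(1) open_ball] by simp
    ultimately have "((\<lambda>z. f (v z) t) has_field_derivative of_real (exp t) * deriv v 0) (at 0)"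
      by (rule DERIV_chain2)
    moreover have "deriv (\<lambda>z. f z s) 0 = deriv (\<lambda>z. f (v z) t) 0"
      by (rule holomorphic_deriv_cong[of unit_disc]) (use v(4) in auto)
    ultimately have "of_real (exp s) = of_real (exp t) * deriv v 0"
      using univalent_discD(4)[OF fs] by (simp add: DERIV_imp_deriv)
    then show ?thesis
      by (simp add: exp_diff)
  qed
  ultimately have "v \<in> univalent_disc (s - t)"
    using v(1) v0 by (simp add: univalent_disc_def)
  then show ?thesis
    using that v by blast
qed

text \<open>Reformulated over the whole real line, where Lebesgue measure is translation invariant,
  so that time can be shifted in either direction without changing the measure space.\<close>

lemma g_Loewner_chain_iff:
  "g_Loewner_chain g f \<longleftrightarrow> Loewner_chain f \<and>
     normal_family {\<lambda>z. of_real (exp (- t)) * f z t | t. t \<ge> 0} \<and>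
     (\<exists>h :: complex \<Rightarrow> real \<Rightarrow> complex. (\<forall>z\<in>unit_disc. h z \<in> borel_measurable lebesgue) \<and>
        (AE t in lebesgue. t \<ge> 0 \<longrightarrow> (\<lambda>z. h z t) \<in> class_M g \<and> (\<forall>z\<in>unit_disc.
           (f z has_vector_derivative deriv (\<lambda>w. f w t) z * h z t) (at t within {0..}))))"
    (is "_ \<longleftrightarrow> _ \<and> _ \<and> (\<exists>h. ?meas h \<and> ?ae h)")
proof -
  define ode :: "(complex \<Rightarrow> real \<Rightarrow> complex) \<Rightarrow> bool" where "ode = (\<lambda>h.
    (\<forall>z\<in>unit_disc. h z \<in> borel_measurable (lebesgue_on {0..})) \<and>
    (AE t in lebesgue_on {0..}. \<forall>z\<in>unit_disc.
       (f z has_vector_derivative deriv (\<lambda>w. f w t) z * h z t) (at t within {0..})) \<and>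
    (AE t in lebesgue_on {0..}. (\<lambda>z. h z t) \<in> class_M g))"
  have AE_eq: "(AE t in lebesgue_on {0..}. P t) \<longleftrightarrow> (AE t in lebesgue. t \<ge> 0 \<longrightarrow> P t)" for P :: "real \<Rightarrow> bool"
    by (subst AE_restrict_space_iff) auto
  have "(\<exists>h. ode h) \<longleftrightarrow> (\<exists>h. ?meas h \<and> ?ae h)"
  proof
    assume "\<exists>h. ode h"
    then obtain h where h: "ode h" ..
    \<comment> \<open>Extension by 0 to negative times keeps measurability; the equation is only
      required for t \<ge> 0.\<close>
    define h' where "h' z t = (if t \<in> {0..} then h z t else 0)" for z t
    have "?meas h'"
    proof
      fix z :: complex assume "z \<in> unit_disc"
      then show "h' z \<in> borel_measurable lebesgue"
        using h unfolding h'_def[abs_def] ode_def by (intro borel_measurable_if_I) auto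
    qed
    moreover have "AE t in lebesgue. 0 \<le> t \<longrightarrow> (\<lambda>z. h z t) \<in> class_M g"
      "AE t in lebesgue. 0 \<le> t \<longrightarrow> (\<forall>z\<in>unit_disc.
         (f z has_vector_derivative deriv (\<lambda>w. f w t) z * h z t) (at t within {0..}))"
      using h unfolding ode_def AE_eq by blast+
    then have "?ae h'"
      by eventually_elim (simp add: h'_def)
    ultimately show "\<exists>h. ?meas h \<and> ?ae h"
      by blast
  next
    assume "\<exists>h. ?meas h \<and> ?ae h"
    then obtain h where h: "?meas h" "?ae h"
      by blast
    have "ode h"
      unfolding ode_def AE_eq
    proof (intro conjI)
      show "\<forall>z\<in>unit_disc. h z \<in> borel_measurable (lebesgue_on {0..})"
        using h(1) by (auto intro: measurable_restrict_space1)
    qed (use h(2) in \<open>eventually_elim; simp\<close>)+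
    then show "\<exists>h. ode h"
      by blast
  qed
  then show ?thesis
    unfolding g_Loewner_chain_def ode_def by blast
qed

section \<open>Normal families\<close>

lemma normal_family_subset: "normal_family \<G> \<Longrightarrow> \<F> \<subseteq> \<G> \<Longrightarrow> normal_family \<F>"
  unfolding normal_family_def by (meson subset_trans)

text \<open>A sequence in the union visits one of the two families infinitely often; enumerating
  those indices gives a subsequence inside a single normal family.\<close>

lemma normal_family_Un:
  assumes "normal_family \<F>" "normal_family \<G>"
  shows "normal_family (\<F> \<union> \<G>)"
  unfolding normal_family_def
proof (intro allI impI)
  fix \<phi> :: "nat \<Rightarrow> complex \<Rightarrow> complex"
  assume \<phi>: "range \<phi> \<subseteq> \<F> \<union> \<G>"
  have "UNIV = {m. \<phi> m \<in> \<F>} \<union> {m. \<phi> m \<in> \<G>}"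
    using \<phi> by auto
  then have "infinite {m. \<phi> m \<in> \<F>} \<or> infinite {m. \<phi> m \<in> \<G>}"
    by (metis finite_UnI infinite_UNIV_nat)
  then obtain \<H> where \<H>: "normal_family \<H>" and inf: "infinite {m. \<phi> m \<in> \<H>}"
    using assms by blast
  let ?e = "enumerate {m. \<phi> m \<in> \<H>}"
  have "range (\<lambda>m. \<phi> (?e m)) \<subseteq> \<H>"
    using enumerate_in_set[OF inf] by blast
  then have "\<exists>r l. strict_mono r \<and> (\<forall>K. compact K \<and> K \<subseteq> unit_disc \<longrightarrow>
      uniform_limit K (\<lambda>m. \<phi> (?e (r m))) l sequentially)"
    by (rule \<H>[unfolded normal_family_def, THEN spec, of "\<lambda>m. \<phi> (?e m)", THEN mp])
  then obtain r l where r: "strict_mono r"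
    "\<forall>K. compact K \<and> K \<subseteq> unit_disc \<longrightarrow> uniform_limit K (\<lambda>m. \<phi> (?e (r m))) l sequentially"
    by (elim exE conjE)
  have "strict_mono (\<lambda>m. ?e (r m))"
    using strict_mono_o[OF strict_mono_enumerate[OF inf] r(1)] by (simp add: o_def)
  with r(2) show "\<exists>r l. strict_mono r \<and> (\<forall>K. compact K \<and> K \<subseteq> unit_disc \<longrightarrow>
      uniform_limit K (\<lambda>m. \<phi> (r m)) l sequentially)"
    by (intro exI[of _ "\<lambda>m. ?e (r m)"] exI[of _ l]) auto
qed

lemma normal_family_Montel:
  assumes "\<And>h. h \<in> \<F> \<Longrightarrow> h holomorphic_on unit_disc"
    and "\<And>r. 0 \<le> r \<Longrightarrow> r < 1 \<Longrightarrow> \<exists>B. \<forall>h\<in>\<F>. \<forall>z\<in>cball 0 r. norm (h z) \<le> B"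
  shows "normal_family \<F>"
  unfolding normal_family_def
proof (intro allI impI)
  fix \<phi> :: "nat \<Rightarrow> complex \<Rightarrow> complex"
  assume \<phi>: "range \<phi> \<subseteq> \<F>"
  have bd: "\<exists>B. \<forall>h\<in>\<F>. \<forall>z\<in>K. norm (h z) \<le> B" if K: "compact K" "K \<subseteq> unit_disc" for K
  proof (cases "K = {}")
    case False
    \<comment> \<open>A point of K farthest from 0 provides a closed disc of radius below 1 that
      contains K.\<close>
    obtain x where x: "x \<in> K" "\<And>y. y \<in> K \<Longrightarrow> norm y \<le> norm x"
      using continuous_attains_sup[OF K(1) False continuous_on_norm_id] by auto
    then have "K \<subseteq> cball 0 (norm x)" "norm x < 1"
      using K(2) by auto
    then show ?thesis
      using assms(2)[of "norm x"] by (meson norm_ge_zero subsetD)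
  qed auto
  obtain l r where "strict_mono r" 
    "\<And>K. compact K \<Longrightarrow> K \<subseteq> unit_disc \<Longrightarrow> uniform_limit K (\<phi> \<circ> r) l sequentially"
    by (rule Montel[OF open_ball assms(1) bd \<phi>]) auto
  then show "\<exists>r l. strict_mono r \<and> (\<forall>K. compact K \<and> K \<subseteq> unit_disc \<longrightarrow>
      uniform_limit K (\<lambda>m. \<phi> (r m)) l sequentially)"
    by (intro exI[of _ r] exI[of _ l]) (simp add: o_def)
qed

section \<open>Restarting and concatenating chains\<close>

text \<open>Transition maps survive the shift, h is translated in time, and the rescaled functions
  e^{-t} e^{-T} f(.,T+t) already belong to the old normal family. The new chain starts at e^{-T}
  f(.,T), which places that function in S_g^0.\<close>

lemma g_Loewner_chain_shift:
  assumes "g_Loewner_chain g f" and T: "T \<ge> 0"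
  shows "g_Loewner_chain g (\<lambda>z s. of_real (exp (- T)) * f z (T + s))"
proof -
  let ?F = "\<lambda>z s. of_real (exp (- T)) * f z (T + s)"
  obtain h where f: "Loewner_chain f"
      "normal_family {\<lambda>z. of_real (exp (- t)) * f z t | t. t \<ge> 0}"
    and h: "\<And>z. z \<in> unit_disc \<Longrightarrow> h z \<in> borel_measurable lebesgue"
      "AE t in lebesgue. t \<ge> 0 \<longrightarrow> (\<lambda>z. h z t) \<in> class_M g \<and> (\<forall>z\<in>unit_disc.
         (f z has_vector_derivative deriv (\<lambda>w. f w t) z * h z t) (at t within {0..}))"
    using assms(1) unfolding g_Loewner_chain_iff by blast
  have "Loewner_chain ?F"
  proof (rule Loewner_chainI)
    fix s :: real assume s: "s \<ge> 0"
    then have "(\<lambda>z. f z (T + s)) \<in> univalent_disc (T + s)"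
      using Loewner_chain_univalent[OF f(1)] T by simp
    then have "(\<lambda>z. ?F z s) \<in> univalent_disc (- T + (T + s) + 0)"
      by (rule compose_univalent(1)[where v = "\<lambda>z. z"]) (auto simp: univalent_disc_def)
    then show "(\<lambda>z. ?F z s) \<in> univalent_disc s"
      by simp
  next
    fix s t :: real assume "0 \<le> s" "s \<le> t"
    then show "\<exists>v. v holomorphic_on unit_disc \<and> v ` unit_disc \<subseteq> unit_disc \<and>
           (\<forall>z\<in>unit_disc. norm (v z) \<le> norm z \<and> ?F z s = ?F (v z) t)"
      using f(1) T unfolding Loewner_chain_def by (metis add_left_mono add_nonneg_nonneg)
  qed
  moreover have "normal_family {\<lambda>z. of_real (exp (- t)) * ?F z t | t. t \<ge> 0}"
  proof (rule normal_family_subset[OF f(2)], safe)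
    fix t :: real assume "t \<ge> 0"
    moreover have "of_real (exp (- t)) * ?F z t = of_real (exp (- (T + t))) * f z (T + t)" for z
      by (simp add: exp_add[symmetric] mult.assoc[symmetric] of_real_mult[symmetric] del: of_real_mult)
    ultimately show "\<exists>t'. (\<lambda>z. of_real (exp (- t)) * ?F z t) = (\<lambda>z. of_real (exp (- t')) * f z t') \<and> 0 \<le> t'"
      using T by (intro exI[of _ "T + t"]) auto
  qed
  moreover have "(\<lambda>t. h z (T + t)) \<in> borel_measurable lebesgue" if "z \<in> unit_disc" for z
    using measurable_compose[OF lebesgue_measurable_translation h(1)[OF that]] .
  moreover have "AE t in lebesgue. t \<ge> 0 \<longrightarrow> (\<lambda>z. h z (T + t)) \<in> class_M g \<and> (\<forall>z\<in>unit_disc.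
         (?F z has_vector_derivative deriv (\<lambda>w. ?F w t) z * h z (T + t)) (at t within {0..}))"
    using AE_lebesgue_translation[OF h(2), of T]
  proof eventually_elim
    case (elim t)
    have "(?F z has_vector_derivative deriv (\<lambda>w. ?F w t) z * h z (T + t)) (at t within {0..})"
      if t: "t \<ge> 0" and z: "z \<in> unit_disc" for z
    proof -
      have "((\<lambda>s. T + s) has_vector_derivative 1) (at t within {0..})"
        by (auto intro!: derivative_eq_intros)
      \<comment> \<open>Derivatives are taken within the half-line. As T \<ge> 0, its translate lies
        in the half-line, so the derivative restricts to the translate.\<close>
      moreover have "(f z has_vector_derivative deriv (\<lambda>w. f w (T + t)) z * h z (T + t))
          (at (T + t) within (\<lambda>s. T + s) ` {0..})"
        by (rule has_vector_derivative_within_subset[where S = "{0..}"]) (use elim t z T in auto)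
      ultimately have "((f z \<circ> (\<lambda>s. T + s)) has_vector_derivative
          1 *\<^sub>R (deriv (\<lambda>w. f w (T + t)) z * h z (T + t))) (at t within {0..})"
        by (rule vector_diff_chain_within)
      then have "(?F z has_vector_derivative
          of_real (exp (- T)) * (1 *\<^sub>R (deriv (\<lambda>w. f w (T + t)) z * h z (T + t)))) (at t within {0..})"
        by (intro has_vector_derivative_mult_right) (simp add: o_def)
      moreover have "(\<lambda>w. f w (T + t)) field_differentiable at z"
        using univalent_discD(1)[OF Loewner_chain_univalent[OF f(1), of "T + t"]] z t T
        by (intro holomorphic_on_imp_differentiable_at[OF _ open_ball]) auto
      then have "deriv (\<lambda>w. ?F w t) z = of_real (exp (- T)) * deriv (\<lambda>w. f w (T + t)) z"
        by (rule deriv_cmult)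
      ultimately show ?thesis
        by (simp add: mult.assoc)
    qed
    with elim T show ?case
      by auto
  qed
  ultimately show ?thesis
    unfolding g_Loewner_chain_iff by (intro conjI exI[of _ "\<lambda>z t. h z (T + t)"]) auto
qed

text \<open>On the time interval before \<open>T\<close> the new chain is \<open>Q (f z s)\<close> with \<open>Q = e\<^sup>T P(\<cdot>,0) \<circ> f(\<cdot>,T)\<^sup>-\<^sup>1\<close>,
  so it solves the Loewner equation with the same \<open>h\<close> as \<open>f\<close>.\<close>
lemma g_Loewner_chain_concat:
  assumes "g_Loewner_chain g f" and "g_Loewner_chain g P" and T: "T \<ge> 0"
    and V: "\<And>s z. 0 \<le> s \<Longrightarrow> s < T \<Longrightarrow> z \<in> unit_disc \<Longrightarrow>
        V s z \<in> unit_disc \<and> f z s = f (V s z) T"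
  shows "g_Loewner_chain g
    (\<lambda>z s. if s < T then of_real (exp T) * P (V s z) 0 else of_real (exp T) * P z (s - T))"
proof -
  define G where
    "G z s = (if s < T then of_real (exp T) * P (V s z) 0 else of_real (exp T) * P z (s - T))" for z s
  obtain h where f: "Loewner_chain f"
    and h: "\<And>z. z \<in> unit_disc \<Longrightarrow> h z \<in> borel_measurable lebesgue"
      "AE t in lebesgue. t \<ge> 0 \<longrightarrow> (\<lambda>z. h z t) \<in> class_M g \<and> (\<forall>z\<in>unit_disc.
         (f z has_vector_derivative deriv (\<lambda>w. f w t) z * h z t) (at t within {0..}))"
    using assms(1) unfolding g_Loewner_chain_iff by blast
  obtain k where P: "Loewner_chain P"
      "normal_family {\<lambda>z. of_real (exp (- t)) * P z t | t. t \<ge> 0}"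
    and k: "\<And>z. z \<in> unit_disc \<Longrightarrow> k z \<in> borel_measurable lebesgue"
      "AE t in lebesgue. t \<ge> 0 \<longrightarrow> (\<lambda>z. k z t) \<in> class_M g \<and> (\<forall>z\<in>unit_disc.
         (P z has_vector_derivative deriv (\<lambda>w. P w t) z * k z t) (at t within {0..}))"
    using assms(2) unfolding g_Loewner_chain_iff by blast
  note fu = Loewner_chain_univalent[OF f] and Pu = Loewner_chain_univalent[OF P(1)]
  have VD: "V s z \<in> unit_disc" "f z s = f (V s z) T" if "0 \<le> s" "s < T" "z \<in> unit_disc" for s z
    using V[OF that] by auto
  \<comment> \<open>V is only a pointwise choice. Injectivity of f(.,T) pins its values down, so V s
    agrees on the disc with a genuine transition map and is therefore holomorphic.\<close>
  have V_unique: "V s z = w" if "0 \<le> s" "s < T" "z \<in> unit_disc" "w \<in> unit_disc" "f z s = f w T" for s z w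
  proof (rule inj_onD[OF univalent_discD(2)[OF fu[OF T]]])
    show "f (V s z) T = f w T"
      using VD(2)[OF that(1-3)] that(5) by simp
  qed (use VD(1)[OF that(1-3)] that in auto)
  have Vu: "V s \<in> univalent_disc (s - T)" "\<And>z. z \<in> unit_disc \<Longrightarrow> norm (V s z) \<le> norm z"
    if s: "0 \<le> s" "s < T" for s
  proof -
    obtain v where v: "v \<in> univalent_disc (s - T)" "v ` unit_disc \<subseteq> unit_disc"
      "\<And>z. z \<in> unit_disc \<Longrightarrow> norm (v z) \<le> norm z" "\<And>z. z \<in> unit_disc \<Longrightarrow> f z s = f (v z) T"
      using Loewner_chain_transition[OF f, of s T] s by auto
    have Vv: "V s z = v z" if "z \<in> unit_disc" for z
      using V_unique[OF s that] v(2,4) that by blast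
    have id: "(\<lambda>z. z) ` unit_disc \<subseteq> unit_disc" "(\<lambda>z. z) \<in> univalent_disc 0"
      by (auto simp: univalent_disc_def)
    have "V s \<in> univalent_disc (0 + (s - T) + 0)"
      by (rule compose_univalent(1)[OF v(1) id(2,1)]) (simp add: Vv)
    then show "V s \<in> univalent_disc (s - T)"
      by simp
    show "\<And>z. z \<in> unit_disc \<Longrightarrow> norm (V s z) \<le> norm z"
      using v(3) Vv by simp
  qed

  have "Loewner_chain G"
  proof (rule Loewner_chainI)
    fix s :: real assume s: "s \<ge> 0"
    show "(\<lambda>z. G z s) \<in> univalent_disc s"
    proof (cases "s < T")
      case True
      have im: "V s ` unit_disc \<subseteq> unit_disc"
        using VD(1)[OF s True] by blast
      have "(\<lambda>z. G z s) \<in> univalent_disc (T + 0 + (s - T))"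
        by (rule compose_univalent(1)[OF Pu[OF order_refl] Vu(1)[OF s True] im])
          (simp add: G_def True)
      then show ?thesis
        by simp
    next
      case False
      then have "(\<lambda>z. P z (s - T)) \<in> univalent_disc (s - T)"
        using Pu by simp
      then have "(\<lambda>z. G z s) \<in> univalent_disc (T + (s - T) + 0)"
        by (rule compose_univalent(1)[where v = "\<lambda>z. z"]) (auto simp: univalent_disc_def G_def False)
      then show ?thesis
        by simp
    qed
  next
    fix s t :: real assume st: "0 \<le> s" "s \<le> t"
    show "\<exists>v. v holomorphic_on unit_disc \<and> v ` unit_disc \<subseteq> unit_disc \<and>
           (\<forall>z\<in>unit_disc. norm (v z) \<le> norm z \<and> G z s = G (v z) t)"
    proof -
      consider "t < T" | "s < T" "T \<le> t" | "T \<le> s"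
        using st by linarith
      then show ?thesis
      proof cases
        case 1
        then have s: "s < T" and t: "0 \<le> t"
          using st by auto
        obtain v where v: "v \<in> univalent_disc (s - t)" "v ` unit_disc \<subseteq> unit_disc"
          "\<And>z. z \<in> unit_disc \<Longrightarrow> norm (v z) \<le> norm z" "\<And>z. z \<in> unit_disc \<Longrightarrow> f z s = f (v z) t"
          using Loewner_chain_transition[OF f st] by auto
        have "G z s = G (v z) t" if z: "z \<in> unit_disc" for z
        proof -
          have vz: "v z \<in> unit_disc"
            using v(2) z by blast
          \<comment> \<open>f(.,T) sends both sides to f z s. Hence before the switch G has the same
            transition maps as f.\<close>
          have "V s z = V t (v z)"
            by (rule V_unique[OF st(1) s z VD(1)[OF t 1 vz]]) (simp add: v(4)[OF z] VD(2)[OF t 1 vz])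
          then show ?thesis
            using s 1 by (simp add: G_def)
        qed
        then show ?thesis
          using v univalent_discD(1)[OF v(1)] by blast
      next
        case 2
        then obtain v where v: "v \<in> univalent_disc (0 - (t - T))" "v ` unit_disc \<subseteq> unit_disc"
          "\<And>z. z \<in> unit_disc \<Longrightarrow> norm (v z) \<le> norm z"
          "\<And>z. z \<in> unit_disc \<Longrightarrow> P z 0 = P (v z) (t - T)"
          using Loewner_chain_transition[OF P(1), of 0 "t - T"] by auto
        have im: "V s ` unit_disc \<subseteq> unit_disc"
          using VD(1)[OF st(1) 2(1)] by blast
        \<comment> \<open>Across the switch the transition map is that of f from s to T, followed by
          that of P from 0 to t - T.\<close>
        have "(\<lambda>z. v (V s z)) holomorphic_on unit_disc"
          using holomorphic_on_compose_gen[OF univalent_discD(1)[OF Vu(1)[OF st(1) 2(1)]]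
            univalent_discD(1)[OF v(1)] im] by (simp add: o_def)
        moreover have "(\<lambda>z. v (V s z)) ` unit_disc \<subseteq> unit_disc"
          using im v(2) by blast
        moreover have "norm (v (V s z)) \<le> norm z \<and> G z s = G (v (V s z)) t" if z: "z \<in> unit_disc" for z
        proof -
          note Vz = VD(1)[OF st(1) 2(1) z]
          show ?thesis
            using v(3,4)[OF Vz] Vu(2)[OF st(1) 2(1) z] 2 by (simp add: G_def)
        qed
        ultimately show ?thesis
          by blast
      next
        case 3
        then obtain v where v: "v \<in> univalent_disc ((s - T) - (t - T))" "v ` unit_disc \<subseteq> unit_disc"
          "\<And>z. z \<in> unit_disc \<Longrightarrow> norm (v z) \<le> norm z"
          "\<And>z. z \<in> unit_disc \<Longrightarrow> P z (s - T) = P (v z) (t - T)"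
          using Loewner_chain_transition[OF P(1), of "s - T" "t - T"] st by auto
        moreover have "G z s = G (v z) t" if "z \<in> unit_disc" for z
          using v(4)[OF that] 3 st by (simp add: G_def)
        ultimately show ?thesis
          using univalent_discD(1)[OF v(1)] by blast
      qed
    qed
  qed
  moreover have "normal_family {\<lambda>z. of_real (exp (- t)) * G z t | t. t \<ge> 0}"
  proof -
    \<comment> \<open>Before the switch the rescaled functions are locally bounded, since |V t z|
      \<le> |z| and e^{-t} e^T \<le> e^T. From T on they are exactly the rescaled functions of
      P.\<close>
    let ?A = "{\<lambda>z. of_real (exp (- t)) * G z t | t. 0 \<le> t \<and> t < T}"
    have "normal_family ?A"
    proof (rule normal_family_Montel)
      fix w assume "w \<in> ?A"
      then obtain t where t: "w = (\<lambda>z. of_real (exp (- t)) * G z t)" "0 \<le> t"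
        by blast
      show "w holomorphic_on unit_disc"
        unfolding t(1) using univalent_discD(1)[OF Loewner_chain_univalent[OF \<open>Loewner_chain G\<close> t(2)]]
        by (intro holomorphic_intros)
    next
      fix r :: real assume r: "0 \<le> r" "r < 1"
      have sub: "cball 0 r \<subseteq> unit_disc"
        using r by auto
      have "continuous_on (cball 0 r) (\<lambda>z. P z 0)"
        using holomorphic_on_imp_continuous_on[OF univalent_discD(1)[OF Pu[OF order_refl]]]
          continuous_on_subset sub by blast
      then have "bounded ((\<lambda>z. P z 0) ` cball 0 r)"
        by (intro compact_imp_bounded compact_continuous_image compact_cball)
      then obtain B where B: "\<And>z. z \<in> cball 0 r \<Longrightarrow> norm (P z 0) \<le> B"
        unfolding bounded_iff by blast
      have "norm (w z) \<le> exp T * B" if wA: "w \<in> ?A" and z: "z \<in> cball 0 r" for w z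
      proof -
        obtain t where t: "w = (\<lambda>z. of_real (exp (- t)) * G z t)" "0 \<le> t" "t < T"
          using wA by blast
        have zD: "z \<in> unit_disc"
          using z sub by blast
        have "V t z \<in> cball 0 r"
          using Vu(2)[OF t(2,3) zD] z by simp
        then have "norm (P (V t z) 0) \<le> B"
          by (rule B)
        moreover have "exp (- t) * exp T \<le> exp T"
          using t(2) by simp
        ultimately have "(exp (- t) * exp T) * norm (P (V t z) 0) \<le> exp T * B"
          by (intro mult_mono) auto
        then show ?thesis
          using t by (simp add: G_def norm_mult mult.assoc)
      qed
      then show "\<exists>B. \<forall>h\<in>?A. \<forall>z\<in>cball 0 r. norm (h z) \<le> B"
        by blast
    qed
    then have un: "normal_family (?A \<union> {\<lambda>z. of_real (exp (- t)) * P z t | t. t \<ge> 0})"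
      using P(2) by (rule normal_family_Un)
    have mem: "(\<lambda>z. of_real (exp (- t)) * G z t) \<in>
        ?A \<union> {\<lambda>z. of_real (exp (- t)) * P z t | t. t \<ge> 0}" if t: "t \<ge> 0" for t
    proof (cases "t < T")
      case False
      have "of_real (exp (- t)) * G z t = of_real (exp (- (t - T))) * P z (t - T)" for z
        using False
        by (simp add: G_def mult.assoc[symmetric] of_real_mult[symmetric] exp_add[symmetric] del: of_real_mult)
      then have "(\<lambda>z. of_real (exp (- t)) * G z t) = (\<lambda>z. of_real (exp (- (t - T))) * P z (t - T))"
        by blast
      with False show ?thesis
        by (intro UnI2 CollectI exI[of _ "t - T"]) simp
    qed (use t in blast)
    show ?thesis
    proof (rule normal_family_subset[OF un], rule subsetI)
      fix w assume "w \<in> {\<lambda>z. of_real (exp (- t)) * G z t | t. t \<ge> 0}"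
      then obtain t where "w = (\<lambda>z. of_real (exp (- t)) * G z t)" "t \<ge> 0"
        by blast
      then show "w \<in> ?A \<union> {\<lambda>z. of_real (exp (- t)) * P z t | t. t \<ge> 0}"
        using mem[of t] by (simp only:)
    qed
  qed
  moreover define H where "H z t = (if t < T then h z t else k z (t - T))" for z t
  have "H z \<in> borel_measurable lebesgue" if z: "z \<in> unit_disc" for z
  proof -
    have "(\<lambda>t. k z (- T + t)) \<in> borel_measurable lebesgue"
      using measurable_compose[OF lebesgue_measurable_translation k(1)[OF z]] .
    then show ?thesis
      unfolding H_def[abs_def] using h(1)[OF z] by (intro measurable_If) (auto simp: add.commute)
  qed
  moreover have "AE t in lebesgue. t \<ge> 0 \<longrightarrow> (\<lambda>z. H z t) \<in> class_M g \<and> (\<forall>z\<in>unit_disc.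
         (G z has_vector_derivative deriv (\<lambda>w. G w t) z * H z t) (at t within {0..}))"
  proof -
    \<comment> \<open>At the switch the left and right velocities may disagree; a single time is a
      null set.\<close>
    have "AE t in lebesgue. t \<noteq> T"
      by (rule AE_I'[of "{T}"]) auto
    with h(2) AE_lebesgue_translation[OF k(2), of "- T"] show ?thesis
    proof eventually_elim
      case (elim t)
      show ?case
      proof (intro impI conjI ballI)
        assume t: "t \<ge> 0"
        show "(\<lambda>z. H z t) \<in> class_M g"
          using elim t by (cases "t < T") (auto simp: H_def)
        fix z assume z: "z \<in> unit_disc"
        show "(G z has_vector_derivative deriv (\<lambda>w. G w t) z * H z t) (at t within {0..})"
        proof (cases "t < T")
          case True
          let ?f = "\<lambda>z. f z T"
          note fT = fu[OF T]
          have ofD: "open (?f ` unit_disc)"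
            using open_mapping_thm3[OF univalent_discD(1)[OF fT] open_ball univalent_discD(2)[OF fT]] .
          obtain W where W: "W holomorphic_on ?f ` unit_disc" "\<And>z. z \<in> unit_disc \<Longrightarrow> W (?f z) = z"
            using holomorphic_has_inverse[OF univalent_discD(1)[OF fT] open_ball univalent_discD(2)[OF fT]]
            by blast
          define Q where "Q w = of_real (exp T) * P (W w) 0" for w
          have "W ` (?f ` unit_disc) \<subseteq> unit_disc"
            using W(2) by auto
          then have "(\<lambda>w. P (W w) 0) holomorphic_on ?f ` unit_disc"
            using holomorphic_on_compose_gen[OF W(1) univalent_discD(1)[OF Pu[OF order_refl]]]
            by (simp add: o_def)
          then have Q: "Q holomorphic_on ?f ` unit_disc"
            unfolding Q_def[abs_def] by (intro holomorphic_intros)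
          have GQ: "G x s = Q (f x s)" "f x s \<in> ?f ` unit_disc"
            if "0 \<le> s" "s < T" "x \<in> unit_disc" for s x
            using W(2)[OF VD(1)[OF that]] VD[OF that] that by (auto simp: G_def Q_def)
          have dQ: "(Q has_field_derivative deriv Q (f z t)) (at (f z t))"
            using holomorphic_derivI[OF Q ofD GQ(2)[OF t True z]] .
          have "(f z has_vector_derivative deriv (\<lambda>w. f w t) z * h z t) (at t within {0..})"
            using elim t z by blast
          then have "((Q \<circ> f z) has_vector_derivative deriv (\<lambda>w. f w t) z * h z t * deriv Q (f z t))
              (at t within {0..})"
            by (rule field_vector_diff_chain_within) (rule has_field_derivative_at_within[OF dQ])
          then have "(G z has_vector_derivative deriv (\<lambda>w. f w t) z * h z t * deriv Q (f z t))
              (at t within {0..})"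
            by (rule has_vector_derivative_transform_within[where d = "T - t"])
              (use True t GQ(1)[OF _ _ z] in \<open>auto simp: dist_real_def\<close>)
          moreover have "deriv (\<lambda>w. G w t) z = deriv Q (f z t) * deriv (\<lambda>w. f w t) z"
          proof -
            have "((\<lambda>w. f w t) has_field_derivative deriv (\<lambda>w. f w t) z) (at z)"
              using holomorphic_derivI[OF univalent_discD(1)[OF fu[OF t]] open_ball z] .
            with dQ have "((\<lambda>w. Q (f w t)) has_field_derivative deriv Q (f z t) * deriv (\<lambda>w. f w t) z) (at z)"
              by (rule DERIV_chain2)
            moreover have "deriv (\<lambda>w. G w t) z = deriv (\<lambda>w. Q (f w t)) z"
              by (rule holomorphic_deriv_cong[of unit_disc]) (use z GQ(1)[OF t True] in auto)
            ultimately show ?thesis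
              by (simp add: DERIV_imp_deriv)
          qed
          ultimately show ?thesis
            using True by (simp add: H_def mult_ac)
        next
          case False
          then have tT: "t > T" "t - T > 0"
            using elim(3) by auto
          have "(P z has_vector_derivative deriv (\<lambda>w. P w (t - T)) z * k z (t - T)) (at (t - T) within {0..})"
            using elim(2) z tT by (simp add: add.commute)
          \<comment> \<open>t - T > 0 is interior to the half-line, so the derivative is two-sided
            and can be moved to t and restricted afterwards.\<close>
          then have "(P z has_vector_derivative deriv (\<lambda>w. P w (t - T)) z * k z (t - T)) (at (t - T))"
            using tT at_within_interior[of "t - T" "{0..}"] by (simp add: interior_real_atLeast)
          then have "((P z \<circ> (\<lambda>s. s - T)) has_vector_derivative
              1 *\<^sub>R (deriv (\<lambda>w. P w (t - T)) z * k z (t - T))) (at t)"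
            by (rule vector_diff_chain_at[rotated]) (auto intro!: derivative_eq_intros)
          then have "((\<lambda>s. of_real (exp T) * P z (s - T)) has_vector_derivative
              of_real (exp T) * (1 *\<^sub>R (deriv (\<lambda>w. P w (t - T)) z * k z (t - T)))) (at t)"
            by (intro has_vector_derivative_mult_right) (simp add: o_def)
          then have "((\<lambda>s. of_real (exp T) * P z (s - T)) has_vector_derivative
              of_real (exp T) * (deriv (\<lambda>w. P w (t - T)) z * k z (t - T))) (at t within {0..})"
            by (simp add: has_vector_derivative_at_within)
          then have "(G z has_vector_derivative
              of_real (exp T) * (deriv (\<lambda>w. P w (t - T)) z * k z (t - T))) (at t within {0..})"
            by (rule has_vector_derivative_transform_within[where d = "t - T"])
              (use tT t in \<open>auto simp: dist_real_def G_def\<close>)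
          moreover have "(\<lambda>w. P w (t - T)) field_differentiable at z"
            using univalent_discD(1)[OF Pu[of "t - T"]] z tT
            by (intro holomorphic_on_imp_differentiable_at[OF _ open_ball]) auto
          then have "deriv (\<lambda>w. of_real (exp T) * P w (t - T)) z = of_real (exp T) * deriv (\<lambda>w. P w (t - T)) z"
            by (rule deriv_cmult)
          ultimately show ?thesis
            using False by (simp add: G_def H_def mult.assoc)
        qed
      qed
    qed
  qed
  ultimately have "g_Loewner_chain g G"
    unfolding g_Loewner_chain_iff by (intro conjI exI[of _ H]) auto
  then show ?thesis
    by (simp only: G_def[abs_def])
qed

subsection \<open>The closure of the class and its transition operators\<close>

lemma univalent_disc_cong:
  assumes "p \<in> univalent_disc s" "\<And>z. z \<in> unit_disc \<Longrightarrow> q z = p z"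
  shows "q \<in> univalent_disc s"
  using compose_univalent(1)[OF assms(1), of "\<lambda>z. z" 0 q 0] assms(2)
  by (auto simp: univalent_disc_def)

lemma class_S0_univalent:
  assumes "p \<in> class_S0 g"
  shows "p \<in> univalent_disc 0"
proof -
  obtain F where F: "g_Loewner_chain g F" "\<And>z. z \<in> unit_disc \<Longrightarrow> p z = F z 0"
    using assms by (auto simp: class_S0_def)
  then have "(\<lambda>z. F z 0) \<in> univalent_disc 0"
    by (intro Loewner_chain_univalent) (auto simp: g_Loewner_chain_def)
  then show ?thesis
    using F(2) by (rule univalent_disc_cong)
qed

section \<open>The topology of locally uniform convergence\<close>

lemma openin_loc_unif_topology_basic:
  assumes "f \<in> hol_disc" "compact K" "K \<subseteq> unit_disc" "e > 0"
  shows "openin loc_unif_topology {p \<in> hol_disc. \<forall>z\<in>K. dist (p z) (f z) < e}"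
  unfolding loc_unif_topology_def by (rule topology_generated_by_Basis) (use assms in blast)

lemma topspace_loc_unif_topology: "topspace loc_unif_topology = hol_disc"
proof
  show "topspace loc_unif_topology \<subseteq> hol_disc"
    unfolding loc_unif_topology_def topology_generated_by_topspace by (rule Union_least) clarsimp
  \<comment> \<open>With K empty a basic open set imposes no condition and is all of
    \<open>hol_disc\<close>.\<close>
  show "hol_disc \<subseteq> topspace loc_unif_topology"
  proof
    fix p assume p: "p \<in> hol_disc"
    then show "p \<in> topspace loc_unif_topology"
      using openin_subset[OF openin_loc_unif_topology_basic[OF p, of "{}" 1]] by auto
  qed
qed

text \<open>Countably many neighbourhoods suffice: closed discs exhausting the unit disc, with
  accuracy 1/(n+1). The resulting sequence is the form in which Hurwitz's theorem can be
  applied.\<close>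

lemma closure_of_loc_unif_sequence:
  assumes "p \<in> loc_unif_topology closure_of S"
  shows "\<exists>q :: nat \<Rightarrow> complex \<Rightarrow> complex. (\<forall>n. q n \<in> S) \<and>
    (\<forall>r<1. uniform_limit (cball 0 r) q p sequentially)"
proof -
  have p: "p \<in> hol_disc" "\<And>U. p \<in> U \<Longrightarrow> openin loc_unif_topology U \<Longrightarrow> \<exists>q\<in>S. q \<in> U"
    using assms by (auto simp: in_closure_of topspace_loc_unif_topology)
  define K where "K n = (cball 0 (1 - inverse (real (Suc n))) :: complex set)" for n
  have "\<exists>q\<in>S. q \<in> {q \<in> hol_disc. \<forall>z\<in>K n. dist (q z) (p z) < inverse (real (Suc n))}" for n
  proof (rule p(2))
    have "K n \<subseteq> unit_disc"
    proof
      fix z assume "z \<in> K n"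
      moreover have "inverse (real (Suc n)) > 0"
        by simp
      ultimately show "z \<in> unit_disc"
        unfolding K_def mem_cball_0 mem_ball_0 by linarith
    qed
    then show "openin loc_unif_topology {q \<in> hol_disc. \<forall>z\<in>K n. dist (q z) (p z) < inverse (real (Suc n))}"
      using p(1) by (intro openin_loc_unif_topology_basic) (auto simp: K_def)
  qed (use p(1) in simp)
  then obtain q where q: "\<And>n. q n \<in> S"
    "\<And>n z. z \<in> K n \<Longrightarrow> dist (q n z) (p z) < inverse (real (Suc n))"
    by (metis (no_types, lifting) mem_Collect_eq)
  have "uniform_limit (cball 0 r) q p sequentially" if "r < 1" for r
    unfolding uniform_limit_iff
  proof (intro allI impI)
    fix e :: real assume "e > 0"
    \<comment> \<open>The bound 1 - r makes \<open>K n\<close> contain the disc of radius r; the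
      bound e gives the accuracy.\<close>
    have "eventually (\<lambda>n. inverse (real (Suc n)) < min e (1 - r)) sequentially"
      using LIMSEQ_inverse_real_of_nat \<open>e > 0\<close> that by (intro order_tendstoD) auto
    then show "\<forall>\<^sub>F n in sequentially. \<forall>z\<in>cball 0 r. dist (q n z) (p z) < e"
    proof eventually_elim
      case (elim n)
      then have "z \<in> K n" if "z \<in> cball 0 r" for z
        using that by (simp add: K_def)
      then show ?case
        using q(2) elim by fastforce
    qed
  qed
  with q(1) show ?thesis
    by blast
qed

text \<open>Values and derivatives at 0 pass to the limit. The limit derivative 1 excludes
  constants, and Hurwitz's theorem then gives injectivity, so the logarithms behind the multipliers
  exist on the whole closure.\<close>

lemma closure_class_S0_univalent:
  assumes "p \<in> loc_unif_topology closure_of class_S0 g"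
  shows "p \<in> univalent_disc 0"
proof -
  obtain q :: "nat \<Rightarrow> complex \<Rightarrow> complex" where qS: "\<And>n. q n \<in> class_S0 g"
    and lim: "\<And>r. r < 1 \<Longrightarrow> uniform_limit (cball 0 r) q p sequentially"
    using closure_of_loc_unif_sequence[OF assms] by blast
  have q: "q n \<in> univalent_disc 0" for n
    using class_S0_univalent[OF qS] .
  have "p \<in> hol_disc"
    using assms by (simp add: in_closure_of topspace_loc_unif_topology)
  then have hol: "p holomorphic_on unit_disc"
    by (simp add: hol_disc_def)
  have lim_half: "uniform_limit (ball 0 (1/2)) q p sequentially"
    by (rule uniform_limit_on_subset[OF lim[of "1/2"]]) auto
  have hol_half: "\<forall>\<^sub>F n in sequentially. q n holomorphic_on ball 0 (1/2)"
    using univalent_discD(1)[OF q] by (intro always_eventually allI) (rule holomorphic_on_subset, auto)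
  have "(\<lambda>n. (deriv ^^ m) (q n) 0) \<longlonglongrightarrow> (deriv ^^ m) p 0" for m
    by (rule higher_deriv_complex_uniform_limit[OF lim_half hol_half]) auto
  from this[of 0] this[of 1] have "(\<lambda>n. q n 0) \<longlonglongrightarrow> p 0" "(\<lambda>n. deriv (q n) 0) \<longlonglongrightarrow> deriv p 0"
    by simp_all
  then have p0: "p 0 = 0" and dp: "deriv p 0 = 1"
    using univalent_discD(3,4)[OF q] by (auto simp: LIMSEQ_const_iff)
  have "inj_on p unit_disc"
  proof (rule Hurwitz_injective[OF open_ball connected_ball _ hol])
    fix K :: "complex set" assume K: "compact K" "K \<subseteq> unit_disc"
    show "uniform_limit K q p sequentially"
    proof (cases "K = {}")
      case False
      obtain x where x: "x \<in> K" "\<And>y. y \<in> K \<Longrightarrow> norm y \<le> norm x"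
        using continuous_attains_sup[OF K(1) False continuous_on_norm_id] by auto
      then have "K \<subseteq> cball 0 (norm x)" "norm x < 1"
        using K(2) by auto
      then show ?thesis
        using lim uniform_limit_on_subset by blast
    qed simp
  next
    show "\<not> p constant_on unit_disc"
    proof
      assume "p constant_on unit_disc"
      then obtain c where "\<And>z. z \<in> unit_disc \<Longrightarrow> p z = c"
        unfolding constant_on_def by blast
      then have "deriv p 0 = deriv (\<lambda>_. c) 0"
        by (intro holomorphic_deriv_cong[of unit_disc]) auto
      with dp show False
        by simp
    qed
  qed (use univalent_discD(1,2)[OF q] in auto)
  with hol p0 dp show ?thesis
    by (simp add: univalent_disc_def)
qed

text \<open>Closeness of images on K follows from closeness on v(K), which is again a compact subset
  of the disc.\<close>

lemma continuous_map_scaled_composition: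
  assumes v: "v holomorphic_on unit_disc" "v ` unit_disc \<subseteq> unit_disc" and c: "c \<noteq> 0"
  shows "continuous_map loc_unif_topology loc_unif_topology (\<lambda>p. restrict (\<lambda>z. c * p (v z)) unit_disc)"
    (is "continuous_map _ _ ?T")
proof -
  have T: "?T p \<in> hol_disc" if p: "p \<in> hol_disc" for p
  proof -
    have "p holomorphic_on unit_disc"
      using p by (simp add: hol_disc_def)
    then have "(\<lambda>z. c * p (v z)) holomorphic_on unit_disc"
      using holomorphic_on_compose_gen[OF v(1) _ v(2)] by (auto intro!: holomorphic_intros simp: o_def)
    then have "?T p holomorphic_on unit_disc"
      by (rule holomorphic_transform) simp
    then show ?thesis
      by (simp add: hol_disc_def)
  qed
  have "openin loc_unif_topology (?T -` U \<inter> hol_disc)"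
    if U: "U = {p \<in> hol_disc. \<forall>z\<in>K. dist (p z) (f z) < e}"
      and f: "f \<in> hol_disc" and K: "compact K" "K \<subseteq> unit_disc" and e: "e > 0" for U f K e
  proof (subst openin_subopen, intro ballI)
    fix p assume p: "p \<in> ?T -` U \<inter> hol_disc"
    \<comment> \<open>Basic open sets are centred at an arbitrary f rather than at the image of p.
      By compactness the strict inequality on K leaves a uniform slack d, which the new
      neighbourhood may spend.\<close>
    obtain d where d: "d > 0" "\<And>z. z \<in> K \<Longrightarrow> dist (?T p z) (f z) \<le> e - d"
    proof (cases "K = {}")
      case False
      have "continuous_on unit_disc (?T p)" "continuous_on unit_disc f"
        using T[of p] p f unfolding hol_disc_def by (blast intro: holomorphic_on_imp_continuous_on)+
      then have "continuous_on K (\<lambda>z. dist (?T p z) (f z))"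
        using continuous_on_subset[OF _ K(2)] by (blast intro: continuous_on_dist)
      then obtain x where x: "x \<in> K" "\<And>z. z \<in> K \<Longrightarrow> dist (?T p z) (f z) \<le> dist (?T p x) (f x)"
        using continuous_attains_sup[OF K(1) False] by blast
      have "dist (?T p x) (f x) < e"
        using p x(1) U by blast
      with x(2) show ?thesis
        by (intro that[of "e - dist (?T p x) (f x)"]) auto
    qed (use that[of e] e in simp)
    define N where "N = {q \<in> hol_disc. \<forall>w\<in>v ` K. dist (q w) (p w) < d / norm c}"
    have "openin loc_unif_topology N"
      unfolding N_def
    proof (rule openin_loc_unif_topology_basic)
      show "compact (v ` K)"
        using compact_continuous_image continuous_on_subset[OF holomorphic_on_imp_continuous_on[OF v(1)] K(2)] K(1)
        by blast
    qed (use p v(2) K(2) d(1) c in auto)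
    moreover have "p \<in> N"
      using p d(1) c by (simp add: N_def)
    moreover have "q \<in> ?T -` U \<inter> hol_disc" if q: "q \<in> N" for q
    proof -
      have qh: "q \<in> hol_disc"
        using q by (simp add: N_def)
      have "dist (?T q z) (f z) < e" if z: "z \<in> K" for z
      proof -
        have zD: "z \<in> unit_disc"
          using z K(2) by blast
        have "dist (?T q z) (?T p z) = norm c * dist (q (v z)) (p (v z))"
          using zD by (simp add: dist_norm right_diff_distrib[symmetric] norm_mult)
        also have "\<dots> < d"
          using q z c by (simp add: N_def field_simps)
        finally show ?thesis
          using d(2)[OF z] dist_triangle[of "?T q z" "f z" "?T p z"] by linarith
      qed
      then show ?thesis
        using U T[OF qh] qh by blast
    qed
    ultimately show "\<exists>N. openin loc_unif_topology N \<and> p \<in> N \<and> N \<subseteq> ?T -` U \<inter> hol_disc"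
      by blast
  qed
  moreover have "?T ` hol_disc \<subseteq> topspace loc_unif_topology"
    using T topspace_loc_unif_topology by blast
  ultimately show ?thesis
    by (subst (2) loc_unif_topology_def, intro continuous_on_generated_topo)
      (auto simp: topspace_loc_unif_topology simp flip: topology_generated_by_topspace loc_unif_topology_def)
qed

section \<open>Invariance under the transition operator\<close>

text \<open>For t > 0 the concatenated chain starts at e^t P(V 0 z, 0), and V 0 = v on the disc by
  injectivity of fc(.,t).\<close>

lemma class_S0_transition:
  assumes fc: "g_Loewner_chain g fc" and t: "t \<ge> 0"
    and v: "v \<in> univalent_disc (- t)" "v ` unit_disc \<subseteq> unit_disc"
      "\<And>z. z \<in> unit_disc \<Longrightarrow> fc z 0 = fc (v z) t"
    and p: "p \<in> class_S0 g"
  shows "restrict (\<lambda>z. of_real (exp t) * p (v z)) unit_disc \<in> class_S0 g" (is "?q \<in> _")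
proof -
  have fL: "Loewner_chain fc"
    using fc by (simp add: g_Loewner_chain_def)
  have "?q \<in> univalent_disc (t + 0 + - t)"
    by (rule compose_univalent(1)[OF class_S0_univalent[OF p] v(1,2)]) simp
  then have q: "?q \<in> univalent_disc 0"
    by simp
  obtain P where P: "g_Loewner_chain g P" "\<And>z. z \<in> unit_disc \<Longrightarrow> p z = P z 0"
    using p by (auto simp: class_S0_def)
  have "\<exists>w. w \<in> unit_disc \<and> fc z s = fc w t" if s: "0 \<le> s" "s < t" and z: "z \<in> unit_disc" for s z
  proof -
    obtain w where "w \<in> univalent_disc (s - t)" "w ` unit_disc \<subseteq> unit_disc"
      "\<And>z. z \<in> unit_disc \<Longrightarrow> norm (w z) \<le> norm z" "\<And>z. z \<in> unit_disc \<Longrightarrow> fc z s = fc (w z) t"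
      using Loewner_chain_transition[OF fL s(1), of t] s(2) by auto
    then show ?thesis
      using z by blast
  qed
  then obtain V where V: "\<And>s z. 0 \<le> s \<Longrightarrow> s < t \<Longrightarrow> z \<in> unit_disc \<Longrightarrow> V s z \<in> unit_disc \<and> fc z s = fc (V s z) t"
    by metis
  let ?G = "\<lambda>z s. if s < t then of_real (exp t) * P (V s z) 0 else of_real (exp t) * P z (s - t)"
  have "g_Loewner_chain g ?G"
    by (rule g_Loewner_chain_concat[OF fc P(1) t V])
  moreover have "?q z = ?G z 0" if z: "z \<in> unit_disc" for z
  proof -
    have vz: "v z \<in> unit_disc"
      using v(2) z by blast
    have inj: "x = v z" if "x \<in> unit_disc" "fc z 0 = fc x t" for x
      using inj_onD[OF univalent_discD(2)[OF Loewner_chain_univalent[OF fL t]]] v(3)[OF z] vz that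
      by metis
    show ?thesis
    proof (cases "0 < t")
      case True
      then show ?thesis
        using inj V[OF order_refl True z] P(2)[OF vz] z by auto
    next
      case False
      \<comment> \<open>Here t = 0: the concatenation starts with P itself, and v is the identity on
        the disc.\<close>
      then have "z = v z"
        using t z by (intro inj) auto
      then show ?thesis
        using False t z P(2)[OF z] by auto
    qed
  qed
  ultimately show ?thesis
    using univalent_discD[OF q] unfolding class_S0_def hol_disc_def by auto
qed

lemma closure_class_S0_transition:
  assumes fc: "g_Loewner_chain g fc" and t: "t \<ge> 0"
    and v: "v \<in> univalent_disc (- t)" "v ` unit_disc \<subseteq> unit_disc"
      "\<And>z. z \<in> unit_disc \<Longrightarrow> fc z 0 = fc (v z) t"
    and p: "p \<in> loc_unif_topology closure_of class_S0 g"
  shows "restrict (\<lambda>z. of_real (exp t) * p (v z)) unit_disc \<in> loc_unif_topology closure_of class_S0 g"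
proof -
  let ?T = "\<lambda>p. restrict (\<lambda>z. of_real (exp t) * p (v z)) unit_disc"
  have "continuous_map loc_unif_topology loc_unif_topology ?T"
    using univalent_discD(1)[OF v(1)] v(2) by (intro continuous_map_scaled_composition) auto
  then have "?T p \<in> loc_unif_topology closure_of (?T ` class_S0 g)"
    using continuous_map_image_closure_subset p by blast
  moreover have "?T ` class_S0 g \<subseteq> class_S0 g"
    using class_S0_transition[OF fc t v] by blast
  ultimately show ?thesis
    using closure_of_mono by blast
qed

section \<open>Transport of extreme points along the chain\<close>

theorem theorem4p1:
  fixes k :: "'n::finite"
    and g f :: "complex \<Rightarrow> complex"
    and \<alpha> \<beta> :: real
    and fc :: "complex \<Rightarrow> real \<Rightarrow> complex"
  assumes "CARD('n) \<ge> 2"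
    and "admissible g"
    and "\<alpha> \<in> {0..1}" and "\<beta> \<in> {0..1/2}" and "\<alpha> + \<beta> \<le> 1"
    and "f \<in> loc_unif_topology closure_of class_S0 g"
    and "g_Loewner_chain g fc"
    and "\<forall>z\<in>unit_disc. f z = fc z 0"
    and "ext_op k \<alpha> \<beta> f
           \<in> extreme_maps (ext_op k \<alpha> \<beta> ` (loc_unif_topology closure_of class_S0 g))"
  shows "\<forall>t\<ge>0. restrict (\<lambda>z. exp (- t) *\<^sub>R ext_chain k \<alpha> \<beta> fc z t) unit_ball
           \<in> extreme_maps (ext_op k \<alpha> \<beta> ` (loc_unif_topology closure_of class_S0 g))"
proof (intro allI impI)
  fix t :: real assume t: "t \<ge> 0"
  let ?A = "loc_unif_topology closure_of class_S0 g"
  let ?\<Phi> = "ext_op k \<alpha> \<beta>"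
  note card = assms(1) and fA = assms(6) and fc = assms(7) and f = assms(8) and ext = assms(9)
  have fL: "Loewner_chain fc"
    using fc by (simp add: g_Loewner_chain_def)
  have A_hol: "p \<in> hol_disc" if "p \<in> ?A" for p
    using that by (simp add: in_closure_of topspace_loc_unif_topology)
  have A_univ: "p \<in> univalent_disc 0" if "p \<in> ?A" for p
    using closure_class_S0_univalent[OF that] .
  define ft where "ft = restrict (\<lambda>z. of_real (exp (- t)) * fc z t) unit_disc"
  \<comment> \<open>This is the restarted chain at time 0, hence the summand 0.\<close>
  have "(\<lambda>z. of_real (exp (- t)) * fc z (t + 0)) \<in> univalent_disc 0"
    using g_Loewner_chain_shift[OF fc t] Loewner_chain_univalent
    unfolding g_Loewner_chain_def by blast
  then have "ft \<in> univalent_disc 0"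
    by (rule univalent_disc_cong) (simp add: ft_def)
  then have "ft \<in> class_S0 g"
    using g_Loewner_chain_shift[OF fc t] univalent_discD[of ft 0]
    by (force simp: class_S0_def hol_disc_def ft_def)
  moreover have "class_S0 g \<subseteq> topspace loc_unif_topology"
    by (auto simp: topspace_loc_unif_topology class_S0_def)
  ultimately have ftA: "ft \<in> ?A"
    using closure_of_subset by blast
  have chain_eq: "restrict (\<lambda>z. exp (- t) *\<^sub>R ext_chain k \<alpha> \<beta> fc z t) unit_ball = ?\<Phi> ft"
    by (rule ext_chain_eq_ext_op[where f = fc and p = ft, OF Loewner_chain_univalent[OF fL t]]) (simp add: ft_def)
  obtain v where "v \<in> univalent_disc (0 - t)" and v: "v ` unit_disc \<subseteq> unit_disc"
      "\<And>z. z \<in> unit_disc \<Longrightarrow> norm (v z) \<le> norm z" "\<And>z. z \<in> unit_disc \<Longrightarrow> fc z 0 = fc (v z) t"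
    using Loewner_chain_transition[OF fL order_refl t] by auto
  then have v: "v \<in> univalent_disc (- t)" "v ` unit_disc \<subseteq> unit_disc"
      "\<And>z. z \<in> unit_disc \<Longrightarrow> fc z 0 = fc (v z) t"
    by simp_all
  define T where "T p = restrict (\<lambda>z. of_real (exp t) * p (v z)) unit_disc" for p :: "complex \<Rightarrow> complex"
  have TA: "T p \<in> ?A" if "p \<in> ?A" for p
    unfolding T_def by (rule closure_class_S0_transition[OF fc t v that])
  have vD: "v z \<in> unit_disc" if "z \<in> unit_disc" for z
    using v(2) that by blast
  \<comment> \<open>On the disc e^t and e^{-t} cancel; off it both sides are undefined, because
    members of \<open>hol_disc\<close> are extensional.\<close>
  have f_eq: "f = T ft"
  proof
    fix z show "f z = T ft z"
    proof (cases "z \<in> unit_disc")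
      case True
      then show ?thesis
        using f v(3)[OF True] vD[OF True]
        by (simp add: T_def ft_def mult.assoc[symmetric] of_real_mult[symmetric] exp_add[symmetric]
            del: of_real_mult)
    next
      case False
      then show ?thesis
        using extensional_arb[of f unit_disc z] A_hol[OF fA] by (simp add: T_def hol_disc_def)
    qed
  qed
  obtain E where "\<forall>p\<in>univalent_disc 0. \<forall>q. (\<forall>z\<in>unit_disc. q z = of_real (exp t) * p (v z)) \<longrightarrow>
      (\<forall>z\<in>unit_disc. ext_factor \<alpha> \<beta> q z = E z * ext_factor \<alpha> \<beta> p (v z))"
    using ext_factor_compose[OF v(1,2)] by blast
  then have E: "ext_factor \<alpha> \<beta> (T p) z = E z * ext_factor \<alpha> \<beta> p (v z)"
    if "p \<in> univalent_disc 0" "z \<in> unit_disc" for p z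
    using that by (simp add: T_def)
  have T_inj: "ft = p" if p: "p \<in> ?A" and eq: "?\<Phi> f = ?\<Phi> (T p)" for p
  proof -
    have "restrict (?\<Phi> (T p)) unit_ball = ?\<Phi> (T p)"
      unfolding ext_op_def by (rule restrict_restrict[THEN trans]) simp
    \<comment> \<open>Equality of the images is written as a convex combination with weight 1, so
      the coordinate criterion yields f = T p on the disc. Cancelling e^t leaves \<open>ft\<close>
      and p equal on the open set v(D).\<close>
    then have "?\<Phi> f = restrict (\<lambda>z. 1 *\<^sub>R ?\<Phi> (T p) z + (1 - 1) *\<^sub>R ?\<Phi> (T p) z) unit_ball"
      using eq by simp
    then have "\<forall>\<zeta>\<in>unit_disc. f \<zeta> = T p \<zeta>"
      unfolding ext_op_eq_convex_iff[OF card] by simp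
    then have "ft w = p w" if "w \<in> v ` unit_disc" for w
      using that unfolding f_eq T_def by auto
    moreover have "open (v ` unit_disc)"
      using open_mapping_thm3 univalent_discD(1,2)[OF v(1)] open_ball by blast
    moreover have "ft holomorphic_on unit_disc" "p holomorphic_on unit_disc"
      using A_hol[OF ftA] A_hol[OF p] by (auto simp: hol_disc_def)
    ultimately have "ft z = p z" if "z \<in> unit_disc" for z
      using analytic_continuation_open[of "v ` unit_disc" unit_disc ft p z] v(2) that by auto
    then show ?thesis
      using A_hol[OF ftA] A_hol[OF p] extensionalityI[of ft unit_disc p] by (simp add: hol_disc_def)
  qed
  have "?\<Phi> ft = ?\<Phi> p \<and> ?\<Phi> ft = ?\<Phi> q"
    if p: "p \<in> ?A" and q: "q \<in> ?A" and u: "0 < u" "u < 1"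
      and eq: "?\<Phi> ft = restrict (\<lambda>z. u *\<^sub>R ?\<Phi> p z + (1 - u) *\<^sub>R ?\<Phi> q z) unit_ball" for p q u
  proof -
    have conv: "ft \<zeta> = u *\<^sub>R p \<zeta> + (1 - u) *\<^sub>R q \<zeta>"
        "ext_factor \<alpha> \<beta> ft \<zeta> = u *\<^sub>R ext_factor \<alpha> \<beta> p \<zeta> + (1 - u) *\<^sub>R ext_factor \<alpha> \<beta> q \<zeta>"
      if "\<zeta> \<in> unit_disc" for \<zeta>
      using eq that unfolding ext_op_eq_convex_iff[OF card] by auto
    \<comment> \<open>The function relation passes through T by linearity; the multiplier relation,
      taken at v(\<zeta>), is multiplied by the common factor \<open>E \<zeta>\<close>.\<close>
    have "?\<Phi> f = restrict (\<lambda>z. u *\<^sub>R ?\<Phi> (T p) z + (1 - u) *\<^sub>R ?\<Phi> (T q) z) unit_ball"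
      unfolding ext_op_eq_convex_iff[OF card] f_eq
    proof (intro ballI conjI)
      fix \<zeta> :: complex assume \<zeta>: "\<zeta> \<in> unit_disc"
      show "T ft \<zeta> = u *\<^sub>R T p \<zeta> + (1 - u) *\<^sub>R T q \<zeta>"
        using \<zeta> by (simp add: T_def conv(1)[OF vD[OF \<zeta>]] algebra_simps)
      show "ext_factor \<alpha> \<beta> (T ft) \<zeta> =
          u *\<^sub>R ext_factor \<alpha> \<beta> (T p) \<zeta> + (1 - u) *\<^sub>R ext_factor \<alpha> \<beta> (T q) \<zeta>"
        unfolding E[OF A_univ[OF ftA] \<zeta>] E[OF A_univ[OF p] \<zeta>] E[OF A_univ[OF q] \<zeta>] conv(2)[OF vD[OF \<zeta>]]
        by (simp add: algebra_simps)
    qed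
    then have "?\<Phi> f = ?\<Phi> (T p)" "?\<Phi> f = ?\<Phi> (T q)"
      using ext TA[OF p] TA[OF q] u unfolding extreme_maps_def by blast+
    then show ?thesis
      using T_inj[OF p] T_inj[OF q] by simp
  qed
  then show "restrict (\<lambda>z. exp (- t) *\<^sub>R ext_chain k \<alpha> \<beta> fc z t) unit_ball
      \<in> extreme_maps (?\<Phi> ` ?A)"
    unfolding chain_eq extreme_maps_def using ftA by blast
qed

end
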